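(* Let $G_n^{T}$ denote the flip graph of triangulations of a convex $n$-gon (defined in the context). Then: (i) if $n\geq 4$, then $G_n^{T}$ has a $1$-rainbow cycle; (ii) if $n\geq 7$, then $G_n^{T}$ has a $2$-rainbow cycle.
   Context: Consider a convex $n$-gon with vertices labeled clockwise $1,\dots,n$. A diagonal is a pair $\{i,j\}$ of vertices that are not adjacent on the polygon; let $E_n$ be the set of all diagonals. The directed graph $G_n^{T}$ has as vertices all triangulations of the $n$-gon. Whenever two triangulations $T,T'$ differ in exactly one diagonal, i.e. $T'$ is obtained from $T$ by removing the diagonal $e$ of a convex quadrilateral formed by two triangles and inserting the other diagonal $f$ of that quadrilateral (a flip), there is an arc $(T,T')$ labeled $f$ and an arc $(T',T)$ labeled $e$ (so each arc is labeled by the diagonal that enters the triangulation). For an integer $r\geq1$, an $r$-rainbow cycle in $G_n^{T}$ is a directed cycle (no repeated vertices) along which every diagonal in $E_n$ appears exactly $r$ times as an arc label. *)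

theory Defs
  imports "Graph_Theory.Arc_Walk"
begin

definition polygon_edges :: "nat \<Rightarrow> nat set set" where
  "polygon_edges n = {{i, i mod n + 1} | i. i \<in> {1..n}}"

definition diagonals :: "nat \<Rightarrow> nat set set" where
  "diagonals n = {{i, j} | i j. i \<in> {1..n} \<and> j \<in> {1..n} \<and> i \<noteq> j} - polygon_edges n"

text \<open>The vertices \<open>a < b < c < d\<close> of a convex polygon span a convex quadrilateral
  with sides \<open>ab\<close>, \<open>bc\<close>, \<open>cd\<close>, \<open>ad\<close>, whose two diagonals are \<open>ac\<close> and \<open>bd\<close>.\<close>

definition quad_diagonals :: "nat \<Rightarrow> nat \<Rightarrow> nat \<Rightarrow> nat \<Rightarrow> nat set \<Rightarrow> nat set \<Rightarrow> bool" where
  "quad_diagonals a b c d e f \<longleftrightarrow>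
     a < b \<and> b < c \<and> c < d \<and> (e = {a, c} \<and> f = {b, d} \<or> e = {b, d} \<and> f = {a, c})"

text \<open>Two segments between polygon vertices intersect in their relative interiors
  iff their endpoints interleave.\<close>

definition crosses :: "nat set \<Rightarrow> nat set \<Rightarrow> bool" where
  "crosses e f \<longleftrightarrow> (\<exists>a b c d. quad_diagonals a b c d e f)"

definition noncrossing :: "nat set set \<Rightarrow> bool" where
  "noncrossing S \<longleftrightarrow> (\<forall>e\<in>S. \<forall>f\<in>S. \<not> crosses e f)"

text \<open>A triangulation is represented by its set of diagonals: an inclusion-maximal set of
  pairwise non-crossing diagonals.\<close>

definition triangulations :: "nat \<Rightarrow> nat set set set" where
  "triangulations n = {T. T \<subseteq> diagonals n \<and> noncrossing T \<and>
     (\<forall>S \<subseteq> diagonals n. noncrossing S \<and> T \<subseteq> S \<longrightarrow> S = T)}"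

definition is_flip ::
  "nat \<Rightarrow> nat set set \<Rightarrow> nat set \<Rightarrow> nat set \<Rightarrow> nat set set \<Rightarrow> bool" where
  "is_flip n T e f T' \<longleftrightarrow>
     T \<in> triangulations n \<and> T' \<in> triangulations n \<and>
     e \<in> T \<and> T' = insert f (T - {e}) \<and>
     (\<exists>a b c d. quad_diagonals a b c d e f \<and>
        {{a, b}, {b, c}, {c, d}, {a, d}} \<subseteq> T \<union> polygon_edges n)"

definition flip_graph :: "nat \<Rightarrow> (nat set set, nat set set \<times> nat set set) pre_digraph" where
  "flip_graph n =
     \<lparr> verts = triangulations n,
       arcs = {(T, T') | T T'. \<exists>e f. is_flip n T e f T'},
       tail = fst, head = snd \<rparr>"

text \<open>The label of an arc is the unique diagonal that enters the triangulation;
  see \<open>flip_label_eq\<close> below.\<close>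

definition flip_label :: "nat set set \<times> nat set set \<Rightarrow> nat set" where
  "flip_label a = the_elem (snd a - fst a)"

text \<open>\<open>pre_digraph.cycle\<close> admits cycles of length two, as needed for the
  pair of opposite arcs that is all of the flip graph of the quadrilateral.\<close>

definition rainbow_cycle ::
  "nat \<Rightarrow> nat \<Rightarrow> (nat set set \<times> nat set set) list \<Rightarrow> bool" where
  "rainbow_cycle n r p \<longleftrightarrow>
     pre_digraph.cycle (flip_graph n) p \<and>
     (\<forall>e \<in> diagonals n. count_list (map flip_label p) e = r)"

lemma crosses_sym: "crosses e f \<longleftrightarrow> crosses f e"
  by (auto simp: crosses_def quad_diagonals_def)

lemma not_crosses_self: "\<not> crosses e e"
  by (auto simp: crosses_def quad_diagonals_def doubleton_eq_iff)

lemma triangulation_crossed: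
  assumes "T \<in> triangulations n" "x \<in> diagonals n" "x \<notin> T"
  shows "\<exists>g\<in>T. crosses g x"
proof (rule ccontr)
  assume "\<not> ?thesis"
  then have "noncrossing (insert x T)"
    using assms(1) not_crosses_self crosses_sym
    by (auto simp: triangulations_def noncrossing_def)
  then show False
    using assms unfolding triangulations_def by blast
qed

lemma side_present:
  assumes T: "T \<in> triangulations n" and T': "T' \<in> triangulations n"
    and T'_eq: "T' = insert f (T - {e})" and e: "e \<in> T"
    and xy: "{x, y} = {a, b} \<or> {x, y} = {b, c} \<or> {x, y} = {c, d} \<or> {x, y} = {a, d}" "x < y"
    and q: "quad_diagonals a b c d e f"
  shows "{x, y} \<in> T \<union> polygon_edges n"
proof (rule ccontr)
  assume neg: "{x, y} \<notin> T \<union> polygon_edges n"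
  have ord: "a < b" "b < c" "c < d" and ef: "{e, f} = {{a, c}, {b, d}}"
    using q by (auto simp: quad_diagonals_def)
  have "e \<in> diagonals n" "f \<in> diagonals n"
    using T T' T'_eq e by (auto simp: triangulations_def)
  then have "{a, c} \<in> diagonals n" "{b, d} \<in> diagonals n"
    using ef by (metis doubleton_eq_iff)+
  then have "a \<in> {1..n}" "b \<in> {1..n}" "c \<in> {1..n}" "d \<in> {1..n}"
    by (auto simp: diagonals_def doubleton_eq_iff)
  then have "{x, y} \<in> diagonals n"
    using neg xy by (fastforce simp: diagonals_def doubleton_eq_iff)
  then obtain g where g: "g \<in> T" "crosses g {x, y}"
    using triangulation_crossed[OF T] neg by blast
  have "g \<noteq> e"
    using g(2) q xy ord by (auto simp: crosses_def quad_diagonals_def doubleton_eq_iff)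
  then have "\<not> crosses g e" "\<not> crosses g f"
    using g(1) e T T' T'_eq by (auto simp: triangulations_def noncrossing_def)
  then have nc: "\<not> crosses g {a, c}" "\<not> crosses g {b, d}"
    using ef by (metis doubleton_eq_iff)+
  obtain u v where uv: "g = {u, v}" "u < v" "u < x \<and> x < v \<and> v < y \<or> x < u \<and> u < y \<and> y < v"
  proof -
    obtain a' b' c' d' where "a' < b'" "b' < c'" "c' < d'"
      "g = {a', c'} \<and> {x, y} = {b', d'} \<or> g = {b', d'} \<and> {x, y} = {a', c'}"
      using g(2) unfolding crosses_def quad_diagonals_def by blast
    moreover from this have "g = {a', c'} \<and> x = b' \<and> y = d' \<or> g = {b', d'} \<and> x = a' \<and> y = c'"
      using xy(2) by (auto simp: doubleton_eq_iff)
    ultimately show thesis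
      using that[of a' c'] that[of b' d'] by auto
  qed
  have cr: "crosses {u, v} {p, q}" if "u < p \<and> p < v \<and> v < q \<or> p < u \<and> u < q \<and> q < v" for p q
    using that unfolding crosses_def quad_diagonals_def by blast
  have "\<not> (u < a \<and> a < v \<and> v < c \<or> a < u \<and> u < c \<and> c < v)"
       "\<not> (u < b \<and> b < v \<and> v < d \<or> b < u \<and> u < d \<and> d < v)"
    using nc cr uv(1) by blast+
  moreover have "x = a \<and> y = b \<or> x = b \<and> y = c \<or> x = c \<and> y = d \<or> x = a \<and> y = d"
    using xy ord by (auto simp: doubleton_eq_iff)
  ultimately show False
    using uv(2,3) ord by linarith
qed

text \<open>The flips are exactly the exchanges of a single diagonal.\<close>

lemma is_flip_iff:
  "is_flip n T e f T' \<longleftrightarrow>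
     T \<in> triangulations n \<and> T' \<in> triangulations n \<and> T - T' = {e} \<and> T' - T = {f}"
proof
  assume fl: "is_flip n T e f T'"
  then have T: "T \<in> triangulations n" "T' \<in> triangulations n" and e: "e \<in> T"
    and T': "T' = insert f (T - {e})" and cr: "crosses e f"
    by (auto simp: is_flip_def crosses_def)
  have "f \<notin> T"
    using T(1) e cr by (auto simp: triangulations_def noncrossing_def)
  then show "T \<in> triangulations n \<and> T' \<in> triangulations n \<and> T - T' = {e} \<and> T' - T = {f}"
    using T e T' by auto
next
  assume *: "T \<in> triangulations n \<and> T' \<in> triangulations n \<and> T - T' = {e} \<and> T' - T = {f}"
  then have T: "T \<in> triangulations n" "T' \<in> triangulations n" and e: "e \<in> T"
    and T': "T' = insert f (T - {e})" and f: "f \<notin> T" "f \<in> T'"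
    by auto
  have "f \<in> diagonals n"
    using T(2) f by (auto simp: triangulations_def)
  then obtain g where g: "g \<in> T" "crosses g f"
    using triangulation_crossed[OF T(1)] f by blast
  have "g = e"
    using g T(2) T' by (auto simp: triangulations_def noncrossing_def)
  then obtain a b c d where q: "quad_diagonals a b c d e f"
    using g by (auto simp: crosses_def)
  then have "a < b" "b < c" "c < d" "a < d"
    by (auto simp: quad_diagonals_def)
  then have "{{a, b}, {b, c}, {c, d}, {a, d}} \<subseteq> T \<union> polygon_edges n"
    using side_present[OF T T' e _ _ q] by blast
  then show "is_flip n T e f T'"
    using T e T' q unfolding is_flip_def by blast
qed

lemma flip_label_eq: "is_flip n T e f T' \<Longrightarrow> flip_label (T, T') = f"
  by (simp add: is_flip_iff flip_label_def)

end

theory Submission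
  imports Defs
begin

text \<open>
  \<^bold>\<open>Two-rainbow cycle.\<close> A double fan consists of the chords from one side \<open>{i, i+1}\<close> of the polygon to
  an apex \<open>k\<close> and of all remaining chords at \<open>i\<close> and \<open>i+1\<close> that do not cross these. Letting \<open>k\<close> run
  around the polygon turns the star at \<open>i\<close> into the star at \<open>i+1\<close> and adds every diagonal at \<open>i+1\<close>
  exactly once; passing through all \<open>n\<close> stars adds each diagonal once for each of its endpoints. The
  ears of a double fan have tips \<open>i-1, i+2\<close> or \<open>i-1, i+1\<close>, which determines \<open>i\<close> as soon as
  \<open>n \<ge> 7\<close>; for \<open>n = 6\<close> the tips \<open>i-1, i+2\<close> are opposite and the walk repeats vertices.

  \<^bold>\<open>One-rainbow cycle.\<close> Fix a vertex \<open>0\<close> and consider the subpolygons \<open>0, lo, ..., h\<close>, with the region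
  outside triangulated by spokes at \<open>0\<close>. Suppose a cycle uses each diagonal of the subpolygon once
  and starts by flipping the star at \<open>0\<close> into the star at \<open>lo\<close>. Replace this first part by a detour
  through the star at the new vertex \<open>h+1\<close>: it adds the diagonals at \<open>h+1\<close>, then again those at
  \<open>lo\<close>, and finally the spoke from \<open>0\<close> to \<open>h\<close>. The new cycle starts by flipping the star at \<open>0\<close>
  into the star at its other neighbour \<open>h+1\<close>, so after reflecting the polygon the step can be repeated.
\<close>

subsection \<open>Flips of triangulations\<close>

lemma crosses_pair_iff:
  assumes "x < y" "u < v"
  shows "crosses {x, y} {u, v} \<longleftrightarrow> x < u \<and> u < y \<and> y < v \<or> u < x \<and> x < v \<and> v < y"
proof
  assume "crosses {x, y} {u, v}"
  then show "x < u \<and> u < y \<and> y < v \<or> u < x \<and> x < v \<and> v < y"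
    using assms by (auto simp: crosses_def quad_diagonals_def doubleton_eq_iff)
next
  assume "x < u \<and> u < y \<and> y < v \<or> u < x \<and> x < v \<and> v < y"
  then show "crosses {x, y} {u, v}"
    unfolding crosses_def quad_diagonals_def by blast
qed

lemma polygon_edges_pair_iff:
  assumes "2 \<le> n" "i < j"
  shows "{i, j} \<in> polygon_edges n \<longleftrightarrow>
    1 \<le> i \<and> j \<le> n \<and> (j = i + 1 \<or> i = 1 \<and> j = n)" (is "?L \<longleftrightarrow> ?R")
proof
  assume ?L
  then obtain k where k: "k \<in> {1..n}" "{i, j} = {k, k mod n + 1}"
    by (auto simp: polygon_edges_def)
  show ?R
  proof (cases "k = n")
    case True
    then show ?thesis using k assms by (auto simp: doubleton_eq_iff)
  next
    case False
    then have "k mod n = k" using k by auto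
    then show ?thesis using k assms False by (auto simp: doubleton_eq_iff)
  qed
next
  assume R: ?R
  have "{i, j} = {k, k mod n + 1} \<and> k \<in> {1..n}" if "k = (if j = i + 1 then i else n)" for k
    using that R assms by (auto simp: doubleton_eq_iff)
  then show ?L unfolding polygon_edges_def by blast
qed

lemma diagonals_pair_iff:
  assumes "2 \<le> n" "i < j"
  shows "{i, j} \<in> diagonals n \<longleftrightarrow> 1 \<le> i \<and> i + 2 \<le> j \<and> j \<le> n \<and> \<not> (i = 1 \<and> j = n)"
proof -
  have "{i, j} \<in> {{i, j} | i j. i \<in> {1..n} \<and> j \<in> {1..n} \<and> i \<noteq> j} \<longleftrightarrow> 1 \<le> i \<and> j \<le> n"
    using assms by (fastforce simp: doubleton_eq_iff)
  then show ?thesis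
    unfolding diagonals_def using polygon_edges_pair_iff[OF assms] assms by auto
qed

lemma diagonals_cases:
  assumes "x \<in> diagonals n" "2 \<le> n"
  obtains i j where "x = {i, j}" "1 \<le> i" "i + 2 \<le> j" "j \<le> n" "\<not> (i = 1 \<and> j = n)"
proof -
  obtain i j where "x = {i, j}" "i < j"
    using assms unfolding diagonals_def by (auto, metis insert_commute linorder_neqE_nat)
  with diagonals_pair_iff[OF assms(2), of i j] assms(1) that show thesis by auto
qed

section \<open>Criterion for exchanging a diagonal\<close>

lemma not_crosses_polygon_edge:
  assumes "x \<in> diagonals n" "y \<in> polygon_edges n" "2 \<le> n"
  shows "\<not> crosses x y"
proof
  assume cr: "crosses x y"
  from assms(1,3) obtain i j where x: "x = {i, j}" "1 \<le> i" "i + 2 \<le> j" "j \<le> n"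
    by (rule diagonals_cases)
  then have ij: "i < j" by simp
  from cr obtain a b c d where "a < b" "b < c" "c < d" "y = {a, c} \<or> y = {b, d}"
    unfolding crosses_def quad_diagonals_def by blast
  then obtain u v where y: "y = {u, v}" "u < v"
    using order.strict_trans by metis
  show False
    using cr assms(2) polygon_edges_pair_iff[OF assms(3) y(2)] crosses_pair_iff[OF ij y(2)] x y
    by auto
qed

text \<open>A segment that meets \<open>f\<close> runs through the interior of the quadrilateral. If
  it crosses no side, its ends are corners, and the corners separated by \<open>f\<close> are the
  ends of \<open>e\<close>. The roles of \<open>e\<close> and \<open>f\<close> can be swapped, which
  \<open>is_flipI\<close> exploits.\<close>

lemma crosses_quad_diagonal:
  assumes "quad_diagonals a b c d e f" "x < y" "crosses {x, y} f" "\<not> crosses {x, y} e"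
    "\<forall>g \<in> {{a, b}, {b, c}, {c, d}, {a, d}}. \<not> crosses {x, y} g"
  shows "{x, y} = e"
proof -
  have ord: "a < b" "b < c" "c < d" "a < c" "b < d" "a < d"
    using assms(1) by (auto simp: quad_diagonals_def)
  note cr = crosses_pair_iff[OF assms(2) ord(1)] crosses_pair_iff[OF assms(2) ord(2)]
    crosses_pair_iff[OF assms(2) ord(3)] crosses_pair_iff[OF assms(2) ord(4)]
    crosses_pair_iff[OF assms(2) ord(5)] crosses_pair_iff[OF assms(2) ord(6)]
  have s: "\<not> crosses {x, y} {a, b}" "\<not> crosses {x, y} {b, c}" "\<not> crosses {x, y} {c, d}"
    "\<not> crosses {x, y} {a, d}"
    using assms(5) by auto
  consider "e = {a, c}" "f = {b, d}" | "e = {b, d}" "f = {a, c}"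
    using assms(1) by (auto simp: quad_diagonals_def)
  then show ?thesis
  proof cases
    case 1
    have "x < b" "b < y" "y < d"
      using s(4) assms(2,3) ord unfolding 1 cr by auto
    then have "x = a \<and> y = c"
      using s assms(2,4) ord unfolding 1 cr by auto
    then show ?thesis using 1 by simp
  next
    case 2
    have "a < x" "x < c" "c < y"
      using s(4) assms(2,3) ord unfolding 2 cr by auto
    then have "x = b \<and> y = d"
      using s assms(2,4) ord unfolding 2 cr by auto
    then show ?thesis using 2 by simp
  qed
qed

text \<open>The substance is that the exchanged set is again a maximal noncrossing set. Both halves
  rest on \<open>crosses_quad_diagonal\<close>: a member of \<open>T\<close> crossing
  \<open>f\<close> must be \<open>e\<close>, and a further diagonal compatible with the new set must
  cross \<open>e\<close>, hence be \<open>f\<close>.\<close>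

lemma is_flipI:
  assumes T: "T \<in> triangulations n" and n: "2 \<le> n" and q: "quad_diagonals a b c d e f"
    and e: "e \<in> T" and fd: "f \<in> diagonals n"
    and sides: "{{a, b}, {b, c}, {c, d}, {a, d}} \<subseteq> T \<union> polygon_edges n"
  shows "is_flip n T e f (insert f (T - {e}))"
proof -
  have Td: "T \<subseteq> diagonals n" and Tn: "noncrossing T"
    using T by (auto simp: triangulations_def)
  have ord: "a < b" "b < c" "c < d"
    using q by (auto simp: quad_diagonals_def)
  have ef: "crosses e f" using q by (auto simp: crosses_def)
  have side_ne: "g \<noteq> e" if "g \<in> {{a, b}, {b, c}, {c, d}, {a, d}}" for g
    using that q ord by (auto simp: quad_diagonals_def doubleton_eq_iff)
  have pair: "\<exists>x y. g = {x, y} \<and> x < y" if "g \<in> diagonals n" for g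
  proof -
    from that n obtain i j where "g = {i, j}" "i + 2 \<le> j" by (rule diagonals_cases)
    then show ?thesis by (intro exI[of _ i] exI[of _ j]) simp
  qed
  have q': "quad_diagonals a b c d f e" using q by (auto simp: quad_diagonals_def)
  have "\<not> crosses g f" if g: "g \<in> T" "g \<noteq> e" for g
  proof
    assume "crosses g f"
    moreover obtain x y where xy: "g = {x, y}" "x < y" using pair g(1) Td by blast
    moreover have "\<not> crosses g e" using Tn g e by (auto simp: noncrossing_def)
    moreover have "\<not> crosses g h" if "h \<in> {{a, b}, {b, c}, {c, d}, {a, d}}" for h
    proof -
      have "h \<in> T \<or> h \<in> polygon_edges n" using that sides by blast
      moreover have "g \<in> diagonals n" using g Td by blast
      ultimately show ?thesis
        using not_crosses_polygon_edge[OF _ _ n] Tn g unfolding noncrossing_def by metis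
    qed
    ultimately show False using crosses_quad_diagonal[OF q] g(2) by metis
  qed
  then have nc: "noncrossing (insert f (T - {e}))"
    using Tn not_crosses_self crosses_sym unfolding noncrossing_def by blast
  have "S = insert f (T - {e})"
    if S: "S \<subseteq> diagonals n" "noncrossing S" "insert f (T - {e}) \<subseteq> S" for S
  proof (rule ccontr)
    assume "S \<noteq> insert f (T - {e})"
    then obtain x where x: "x \<in> S" "x \<noteq> f" "x \<notin> T \<or> x = e" using S by blast
    have xe: "x \<noteq> e" using S x ef unfolding noncrossing_def by blast
    then obtain g where g: "g \<in> T" "crosses g x"
      using triangulation_crossed[OF T, of x] x S by blast
    \<comment> \<open>\<open>S\<close> contains every member of \<open>T\<close> other than
      \<open>e\<close>, so only \<open>e\<close> can block \<open>x\<close>.\<close>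
    have "g = e" using g S x unfolding noncrossing_def by blast
    then have "crosses x e" using g crosses_sym by blast
    moreover obtain u v where uv: "x = {u, v}" "u < v" using pair x S by blast
    moreover have "\<not> crosses x f" using S x unfolding noncrossing_def by blast
    moreover have "\<not> crosses x h" if h: "h \<in> {{a, b}, {b, c}, {c, d}, {a, d}}" for h
    proof -
      have "h \<in> S \<or> h \<in> polygon_edges n" using h side_ne[OF h] sides S by blast
      moreover have "x \<in> diagonals n" using x S by blast
      ultimately show ?thesis
        using not_crosses_polygon_edge[OF _ _ n] S x unfolding noncrossing_def by metis
    qed
    ultimately show False using crosses_quad_diagonal[OF q'] x(2) by metis
  qed
  then have "insert f (T - {e}) \<in> triangulations n"
    using nc Td fd unfolding triangulations_def by blast
  then show ?thesis
    using T e q sides unfolding is_flip_def by blast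
qed

subsection \<open>Cyclic coordinates\<close>

text \<open>Vertices are addressed by integers modulo \<open>n\<close>, with the label \<open>1\<close> at position \<open>0\<close>; the sign
  \<open>s = \<plusminus>1\<close> selects the orientation.\<close>

definition vx :: "nat \<Rightarrow> int \<Rightarrow> int \<Rightarrow> nat" where
  "vx n s i = nat ((s * i) mod int n) + 1"

definition chord :: "nat \<Rightarrow> int \<Rightarrow> int \<Rightarrow> int \<Rightarrow> nat set" where
  "chord n s i j = {vx n s i, vx n s j}"

definition star :: "nat \<Rightarrow> int \<Rightarrow> nat set set" where
  "star n s = {chord n s 0 j | j. 2 \<le> j \<and> j \<le> int n - 2}"

lemma vx_shift: "vx n s (i + int n) = vx n s i"
  by (simp add: vx_def distrib_left)

lemma vx_shift_mult: "vx n s (i + int n * k) = vx n s i"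
  by (simp add: vx_def distrib_left mult.left_commute[of s])

lemma vx_minus: "vx n (- s) i = vx n s (- i)"
  by (simp add: vx_def)

lemma vx_eq_iff:
  assumes "0 < n" "\<bar>s\<bar> = 1"
  shows "vx n s i = vx n s j \<longleftrightarrow> int n dvd i - j"
proof -
  have "vx n s i = vx n s j \<longleftrightarrow> (s * i) mod int n = (s * j) mod int n"
    using assms by (simp add: vx_def eq_nat_nat_iff)
  also have "\<dots> \<longleftrightarrow> int n dvd s * (i - j)"
    by (simp add: mod_eq_dvd_iff right_diff_distrib)
  also have "\<dots> \<longleftrightarrow> int n dvd i - j"
    using assms(2) by (cases "s = 1") (auto simp: abs_if dvd_diff_commute split: if_splits)
  finally show ?thesis .
qed

lemma vx_pos:
  assumes "0 \<le> i" "i < int n"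
  shows "vx n 1 i = nat i + 1"
  using assms by (simp add: vx_def)

lemma chord_commute: "chord n s i j = chord n s j i"
  by (auto simp: chord_def)

text \<open>Shifting by a multiple of \<open>n\<close> puts \<open>i\<close> into the range from
  \<open>0\<close> to \<open>n - 1\<close>. The labels then increase except for one wrap past
  \<open>n\<close>, which a rotation of the four corners repairs; it may swap the two diagonals, as
  \<open>quad_diagonals\<close> permits. For \<open>s = - 1\<close> negating the positions reverses
  the order.\<close>

lemma chord_quad:
  assumes s: "\<bar>s\<bar> = 1" and ord: "i < j" "j < k" "k < l" "l < i + int n"
  obtains a b c d where "quad_diagonals a b c d (chord n s i k) (chord n s j l)"
    "{{a, b}, {b, c}, {c, d}, {a, d}} = {chord n s i j, chord n s j k, chord n s k l, chord n s i l}"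
proof -
  have pos: "\<exists>a b c d. quad_diagonals a b c d (chord n 1 i k) (chord n 1 j l) \<and>
    {{a, b}, {b, c}, {c, d}, {a, d}} = {chord n 1 i j, chord n 1 j k, chord n 1 k l, chord n 1 i l}"
    if ord: "i < j" "j < k" "k < l" "l < i + int n" for i j k l
  proof -
    define m where "m = i div int n"
    define v where "v x = nat x + 1" for x :: int
    define i' j' k' l' where "i' = i - int n * m" and "j' = j - int n * m"
      and "k' = k - int n * m" and "l' = l - int n * m"
    have b: "0 \<le> i'" "i' < int n"
      using ord by (auto simp: i'_def m_def minus_mult_div_eq_mod)
    have ord': "i' < j'" "j' < k'" "k' < l'" "l' < i' + int n"
      using ord by (auto simp: i'_def j'_def k'_def l'_def)
    have "vx n 1 x = vx n 1 (x - int n * m)" for x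
      using vx_shift_mult[of n 1 "x - int n * m" m] by simp
    then have eqs: "vx n 1 i = vx n 1 i'" "vx n 1 j = vx n 1 j'" "vx n 1 k = vx n 1 k'"
      "vx n 1 l = vx n 1 l'"
      unfolding i'_def j'_def k'_def l'_def by auto
    have lo: "vx n 1 x = v x" if "0 \<le> x" "x < int n" for x
      using vx_pos[OF that] by (simp add: v_def)
    have hi: "vx n 1 x = v (x - int n)" if "int n \<le> x" "x < 2 * int n" for x
      using lo[of "x - int n"] vx_shift[of n 1 "x - int n"] that by simp
    have mono: "v x < v y" if "0 \<le> x" "x < y" for x y
      using that by (auto simp: v_def)
    \<comment> \<open>The cases say how many of the corners have passed position
      \<open>n\<close>.\<close>
    consider "l' < int n" | "k' < int n" "int n \<le> l'" | "j' < int n" "int n \<le> k'" | "int n \<le> j'"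
      by linarith
    then show ?thesis
    proof cases
      case 1
      show ?thesis
        by (rule exI[of _ "v i'"], rule exI[of _ "v j'"], rule exI[of _ "v k'"], rule exI[of _ "v l'"])
          (use 1 b ord' in \<open>auto simp: quad_diagonals_def chord_def eqs lo mono\<close>)
    next
      case 2
      show ?thesis
        by (rule exI[of _ "v (l' - int n)"], rule exI[of _ "v i'"], rule exI[of _ "v j'"], rule exI[of _ "v k'"])
          (use 2 b ord' in \<open>auto simp: quad_diagonals_def chord_def eqs lo hi mono\<close>)
    next
      case 3
      show ?thesis
        by (rule exI[of _ "v (k' - int n)"], rule exI[of _ "v (l' - int n)"], rule exI[of _ "v i'"], rule exI[of _ "v j'"])
          (use 3 b ord' in \<open>auto simp: quad_diagonals_def chord_def eqs lo hi mono\<close>)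
    next
      case 4
      show ?thesis
        by (rule exI[of _ "v (j' - int n)"], rule exI[of _ "v (k' - int n)"], rule exI[of _ "v (l' - int n)"], rule exI[of _ "v i'"])
          (use 4 b ord' in \<open>auto simp: quad_diagonals_def chord_def eqs lo hi mono\<close>)
    qed
  qed
  show thesis
  proof (cases "s = 1")
    case True
    then show thesis using pos[OF ord] that by blast
  next
    case False
    then have "s = - 1" using s by auto
    then have ch: "chord n s x y = chord n 1 (- y) (- x)" for x y
      using vx_minus[of n 1] by (auto simp: chord_def)
    have "- l < - k" "- k < - j" "- j < - i" "- i < - l + int n" using ord by auto
    from pos[OF this] obtain a b c d where
      q: "quad_diagonals a b c d (chord n s j l) (chord n s i k)"
      "{{a, b}, {b, c}, {c, d}, {a, d}} = {chord n s k l, chord n s j k, chord n s i j, chord n s i l}"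
      unfolding ch chord_commute[of n 1 "- l" "- i"] by blast
    show thesis
      by (rule that[of a b c d]) (use q in \<open>auto simp: quad_diagonals_def\<close>)
  qed
qed


lemma vx_range: "0 < n \<Longrightarrow> vx n s i \<in> {1..n}"
  by (auto simp: vx_def Suc_le_eq nat_less_iff)

text \<open>Among \<open>n\<close> consecutive positions each vertex occurs once, so indices can be
  compared directly. The start \<open>w\<close> is free because double fans use the window beginning
  at \<open>i\<close>, the fans of subpolygons the one beginning at \<open>0\<close>.\<close>

lemma chord_eq_iff:
  assumes "\<bar>s\<bar> = 1" "w \<le> i" "i < w + int n" "w \<le> j" "j < w + int n"
    "w \<le> k" "k < w + int n" "w \<le> l" "l < w + int n"
  shows "chord n s i j = chord n s k l \<longleftrightarrow> i = k \<and> j = l \<or> i = l \<and> j = k"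
proof -
  have "vx n s x = vx n s y \<longleftrightarrow> x = y"
    if "w \<le> x" "x < w + int n" "w \<le> y" "y < w + int n" for x y
  proof -
    have "int n dvd x - y \<longleftrightarrow> x = y"
      using that zdvd_not_zless[of "\<bar>x - y\<bar>" "int n"] by (cases "x = y") auto
    then show ?thesis using vx_eq_iff[of n s x y] assms(1) that by auto
  qed
  then show ?thesis using assms by (simp add: chord_def doubleton_eq_iff)
qed

lemma chord_edge:
  assumes "\<bar>s\<bar> = 1" "0 < n" "j = i + 1"
  shows "chord n s i j \<in> polygon_edges n"
proof -
  have pos: "chord n 1 i (i + 1) \<in> polygon_edges n" for i
  proof -
    define k where "k = vx n 1 i"
    have "k \<in> {1..n}" unfolding k_def using vx_range assms(2) by blast
    moreover have "vx n 1 (i + 1) = k mod n + 1"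
    proof -
      have "int (k mod n) = (i + 1) mod int n"
        using assms(2) by (simp add: k_def vx_def zmod_int mod_add_left_eq add.commute mod_simps)
      then show ?thesis by (simp add: vx_def)
    qed
    ultimately have "chord n 1 i (i + 1) = {k, k mod n + 1}" "k \<in> {1..n}"
      by (auto simp: chord_def k_def)
    then show ?thesis unfolding polygon_edges_def by blast
  qed
  show ?thesis
  proof (cases "s = 1")
    case False
    then have "s = - 1" using assms(1) by auto
    then have "chord n s i j = chord n 1 (- j) (- j + 1)"
      using assms(3) vx_minus[of n 1] by (auto simp: chord_def)
    then show ?thesis using pos[of "- j"] by (simp only:)
  qed (use pos assms in simp)
qed

lemma chord_shift: "chord n s i (j + int n) = chord n s i j" "chord n s (i + int n) j = chord n s i j"
  by (simp_all add: chord_def vx_shift)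

text \<open>The criterion \<open>is_flipI\<close> in cyclic positions. The entering chord is a
  diagonal because opposite corners are separated on either side by the other two.\<close>

lemma chord_flip:
  assumes s: "\<bar>s\<bar> = 1" and ord: "i < j" "j < k" "k < l" "l < i + int n"
    and T: "T \<in> triangulations n" and e: "chord n s i k \<in> T"
    and sides: "chord n s i j \<in> T \<union> polygon_edges n" "chord n s j k \<in> T \<union> polygon_edges n"
      "chord n s k l \<in> T \<union> polygon_edges n" "chord n s i l \<in> T \<union> polygon_edges n"
  shows "is_flip n T (chord n s i k) (chord n s j l) (insert (chord n s j l) (T - {chord n s i k}))"
proof -
  from s ord obtain a b c d where
    q: "quad_diagonals a b c d (chord n s i k) (chord n s j l)"
    and sd: "{{a, b}, {b, c}, {c, d}, {a, d}} = {chord n s i j, chord n s j k, chord n s k l, chord n s i l}"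
    by (rule chord_quad)
  have n: "2 \<le> n" "0 < n" using ord by auto
  have un: "{a, b, c, d} = chord n s i k \<union> chord n s j l"
    using q by (auto simp: quad_diagonals_def)
  also have "\<dots> \<subseteq> {1..n}" using vx_range[OF n(2)] by (auto simp: chord_def)
  finally have ran: "1 \<le> a" "d \<le> n" by auto
  have abcd: "a < b" "b < c" "c < d" "a < c" "b < d" using q by (auto simp: quad_diagonals_def)
  have "{a, c} \<in> diagonals n" "{b, d} \<in> diagonals n"
    using ran abcd diagonals_pair_iff[OF n(1) abcd(4)] diagonals_pair_iff[OF n(1) abcd(5)] by auto
  then have "chord n s j l \<in> diagonals n"
    using q by (auto simp: quad_diagonals_def)
  then show ?thesis
    using is_flipI[OF T n(1) q e] sides unfolding sd by blast
qed

text \<open>Reflection at position \<open>0\<close> permutes the spokes. Hence a walk ending at the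
  star may be described in either orientation.\<close>

lemma star_minus: "star n (- s) = star n s"
proof -
  have ch: "chord n (- s) 0 j = chord n s 0 (int n - j)" for s j
    using vx_shift[of n s "- j"] by (simp add: chord_def vx_minus)
  have "star n (- s) \<subseteq> star n s" for s
  proof
    fix x assume "x \<in> star n (- s)"
    then obtain j where "x = chord n s 0 (int n - j)" "2 \<le> j" "j \<le> int n - 2"
      by (auto simp: star_def ch)
    then show "x \<in> star n s" unfolding star_def by force
  qed
  from this[of s] this[of "- s"] show ?thesis by simp
qed

text \<open>A diagonal \<open>{i, j}\<close> missing the vertex \<open>1\<close> is crossed by the
  spoke \<open>{1, i + 1}\<close>, which gives maximality. This is the only triangulation verified
  directly; all others arise by flips.\<close>

lemma star_triangulation:
  assumes "4 \<le> n" "\<bar>s\<bar> = 1"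
  shows "star n s \<in> triangulations n"
proof -
  have "star n s = star n 1" using assms(2) star_minus[of n 1] by (auto simp: abs_if split: if_splits)
  also have "\<dots> = {{1, j} | j. 3 \<le> j \<and> j \<le> n - 1}" (is "_ = ?S")
  proof (intro set_eqI iffI)
    fix x assume "x \<in> star n 1"
    then obtain j where j: "x = chord n 1 0 j" "2 \<le> j" "j \<le> int n - 2"
      by (auto simp: star_def)
    then have "x = {1, nat j + 1}" using vx_pos[of j n] vx_pos[of 0 n] by (auto simp: chord_def)
    moreover have "3 \<le> nat j + 1" "nat j + 1 \<le> n - 1" using j by auto
    ultimately show "x \<in> ?S" by blast
  next
    fix x assume "x \<in> ?S"
    then obtain j where j: "x = {1, j}" "3 \<le> j" "j \<le> n - 1" by blast
    then have "x = chord n 1 0 (int j - 1)"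
      using vx_pos[of "int j - 1" n] vx_pos[of 0 n] by (auto simp: chord_def)
    moreover have "2 \<le> int j - 1" "int j - 1 \<le> int n - 2" using j assms(1) by auto
    ultimately show "x \<in> star n 1" unfolding star_def by blast
  qed
  also have "?S \<in> triangulations n"
  proof -
    have dg: "?S \<subseteq> diagonals n"
    proof
      fix x assume "x \<in> ?S"
      then obtain j where j: "x = {1, j}" "3 \<le> j" "j \<le> n - 1" by blast
      then show "x \<in> diagonals n" using diagonals_pair_iff[of n 1 j] assms(1) by auto
    qed
    have nc: "noncrossing ?S"
    proof -
      have "\<not> crosses {1, j} {1, k}" if "3 \<le> j" "3 \<le> k" for j k
        using crosses_pair_iff[of 1 j 1 k] that by auto
      then show ?thesis unfolding noncrossing_def by blast
    qed
    have "S = ?S" if S: "S \<subseteq> diagonals n" "noncrossing S" "?S \<subseteq> S" for S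
    proof (rule ccontr)
      assume "S \<noteq> ?S"
      then obtain x where x: "x \<in> S" "x \<notin> ?S" using S(3) by blast
      then have "x \<in> diagonals n" "2 \<le> n" using S assms(1) by auto
      then obtain i j where ij: "x = {i, j}" "1 \<le> i" "i + 2 \<le> j" "j \<le> n" "\<not> (i = 1 \<and> j = n)"
        by (rule diagonals_cases)
      have "i \<noteq> 1"
      proof
        assume "i = 1"
        then have "x = {1, j}" "3 \<le> j" "j \<le> n - 1" using ij by auto
        then show False using x(2) by blast
      qed
      then have "{1, i + 1} \<in> ?S" "crosses {1, i + 1} {i, j}"
        using ij crosses_pair_iff[of 1 "i + 1" i j] by auto
      then show False using S x(1) ij(1) unfolding noncrossing_def by blast
    qed
    then show ?thesis using dg nc unfolding triangulations_def by blast
  qed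
  finally show ?thesis .
qed

lemma chord_eq_dvd_iff:
  assumes "0 < n" "\<bar>s\<bar> = 1"
  shows "chord n s i j = chord n s k l \<longleftrightarrow>
    int n dvd i - k \<and> int n dvd j - l \<or> int n dvd i - l \<and> int n dvd j - k"
  using assms by (simp add: chord_def doubleton_eq_iff vx_eq_iff)

lemma diagonal_is_chord:
  assumes "e \<in> diagonals n" "2 \<le> n"
  obtains x y where "e = chord n 1 x y" "0 \<le> x" "x + 2 \<le> y" "y < int n" "\<not> (x = 0 \<and> y = int n - 1)"
proof -
  from assms obtain i j where ij: "e = {i, j}" "1 \<le> i" "i + 2 \<le> j" "j \<le> n" "\<not> (i = 1 \<and> j = n)"
    by (rule diagonals_cases)
  have "e = chord n 1 (int i - 1) (int j - 1)"
    using ij vx_pos[of "int i - 1" n] vx_pos[of "int j - 1" n] by (auto simp: chord_def)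
  then show thesis by (rule that) (use ij in auto)
qed

subsection \<open>Walks in the flip graph\<close>

lemma wf_flip_graph: "wf_digraph (flip_graph n)"
  by unfold_locales (auto simp: flip_graph_def is_flip_def)

definition flip_walk where
  "flip_walk n = pre_digraph.awalk (flip_graph n)"

definition steps :: "(nat \<Rightarrow> 'a) \<Rightarrow> nat \<Rightarrow> ('a \<times> 'a) list" where
  "steps f m = map (\<lambda>i. (f i, f (Suc i))) [0..<m]"

lemma flip_walk_append:
  "flip_walk n u p v \<Longrightarrow> flip_walk n v q w \<Longrightarrow> flip_walk n u (p @ q) w"
  unfolding flip_walk_def using wf_digraph.awalk_appendI[OF wf_flip_graph] by blast

text \<open>Each flip hypothesis may assume that its source is a triangulation, so only
  \<open>f 0\<close> has to be checked: a flip certifies its target.\<close>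

lemma flip_walk_steps:
  assumes "f 0 \<in> triangulations n"
    "\<And>i. i < m \<Longrightarrow> f i \<in> triangulations n \<Longrightarrow> is_flip n (f i) (e i) (l i) (f (Suc i))"
  shows "flip_walk n (f 0) (steps f m) (f m)"
    and "map flip_label (steps f m) = map l [0..<m]"
proof -
  have tri: "f i \<in> triangulations n" if "i \<le> m" for i
    using that
  proof (induction i)
    case (Suc i)
    then have "is_flip n (f i) (e i) (l i) (f (Suc i))" using assms(2) by simp
    then show ?case using is_flip_iff by blast
  qed (use assms(1) in simp)
  then have fl: "is_flip n (f i) (e i) (l i) (f (Suc i))" if "i < m" for i
    using assms(2) that by simp
  have "flip_walk n (f 0) (steps f k) (f k)" if "k \<le> m" for k
    using that
  proof (induction k)
    case 0
    then show ?case
      using assms(1)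
      by (simp add: steps_def flip_walk_def pre_digraph.awalk_def pre_digraph.cas.simps flip_graph_def)
  next
    case (Suc k)
    have "flip_walk n (f k) [(f k, f (Suc k))] (f (Suc k))"
      using fl[of k] tri[of k] Suc.prems
      unfolding flip_walk_def pre_digraph.awalk_def flip_graph_def
      by (auto simp: pre_digraph.cas.simps)
    moreover have "steps f (Suc k) = steps f k @ [(f k, f (Suc k))]"
      by (simp add: steps_def)
    moreover have "flip_walk n (f 0) (steps f k) (f k)" using Suc by simp
    ultimately show ?case using flip_walk_append by metis
  qed
  then show "flip_walk n (f 0) (steps f m) (f m)" by simp
  show "map flip_label (steps f m) = map l [0..<m]"
    using fl flip_label_eq by (fastforce simp: steps_def)
qed

lemma map_snd_steps: "map snd (steps f m) = map (\<lambda>i. f (Suc i)) [0..<m]"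
  by (simp add: steps_def)

text \<open>On a closed walk the vertices after the first are the heads of the arcs, so the cycle
  condition becomes distinctness of \<open>map snd p\<close>.\<close>

lemma rainbow_cycleI:
  assumes "flip_walk n u p u" "p \<noteq> []" "distinct (map snd p)"
    "\<And>e. e \<in> diagonals n \<Longrightarrow> count_list (map flip_label p) e = r"
  shows "rainbow_cycle n r p"
proof -
  have "pre_digraph.cas (flip_graph n) u p u"
    using assms(1) by (simp add: flip_walk_def pre_digraph.awalk_def)
  then have "tl (pre_digraph.awalk_verts (flip_graph n) u p) = map snd p"
    using assms(2) by (simp add: pre_digraph.awalk_verts_conv' flip_graph_def)
  then show ?thesis
    using assms unfolding rainbow_cycle_def pre_digraph.cycle_def flip_walk_def by metis
qed

subsection \<open>The two-rainbow cycle\<close>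

text \<open>With \<open>k = i + 2\<close> this is the star at \<open>i\<close>, with
  \<open>k = i + n - 1\<close> the star at \<open>i + 1\<close>; the other family is then empty.
  Positions run past \<open>n\<close> instead of being reduced.\<close>

definition double_fan :: "nat \<Rightarrow> int \<Rightarrow> int \<Rightarrow> nat set set" where
  "double_fan n i k = {chord n 1 (i + 1) j | j. i + 3 \<le> j \<and> j \<le> k} \<union>
     {chord n 1 i j | j. k \<le> j \<and> j \<le> i + int n - 2}"

text \<open>The quadrilateral has corners \<open>i, i + 1, k, k + 1\<close>. Its sides from
  \<open>i + 1\<close> to \<open>k\<close> and from \<open>i\<close> to \<open>k + 1\<close> belong
  to the fan, or become polygon edges at the two ends of the range of \<open>k\<close>.\<close>

lemma double_fan_flip:
  assumes "4 \<le> n" "i + 2 \<le> k" "k \<le> i + int n - 2" "double_fan n i k \<in> triangulations n"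
  shows "is_flip n (double_fan n i k) (chord n 1 i k) (chord n 1 (i + 1) (k + 1)) (double_fan n i (k + 1))"
proof -
  let ?T = "double_fan n i k"
  have ne: "chord n 1 i k \<noteq> chord n 1 (i + 1) j" if "i + 3 \<le> j" "j \<le> k + 1" for j
    using chord_eq_iff[of 1 i i n k "i + 1" j] assms that by simp
  have ne': "chord n 1 i k \<noteq> chord n 1 i j" if "k < j" "j \<le> i + int n - 2" for j
    using chord_eq_iff[of 1 i i n k i j] assms that by simp
  have "double_fan n i (k + 1) = insert (chord n 1 (i + 1) (k + 1)) (?T - {chord n 1 i k})" (is "?L = ?R")
  proof
    show "?L \<subseteq> ?R"
    proof
      fix x assume "x \<in> ?L"
      then consider j where "x = chord n 1 (i + 1) j" "i + 3 \<le> j" "j \<le> k + 1"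
        | j where "x = chord n 1 i j" "k + 1 \<le> j" "j \<le> i + int n - 2"
        unfolding double_fan_def by blast
      then show "x \<in> ?R"
      proof cases
        case (1 j)
        then have "j = k + 1 \<or> j \<le> k" by linarith
        then show ?thesis using 1 ne[of j] unfolding double_fan_def by auto
      next
        case (2 j)
        then have "k \<le> j" "k < j" by auto
        then show ?thesis using 2 ne'[of j] unfolding double_fan_def by auto
      qed
    qed
    show "?R \<subseteq> ?L"
    proof
      fix x assume "x \<in> ?R"
      then consider "x = chord n 1 (i + 1) (k + 1)"
        | j where "x = chord n 1 (i + 1) j" "i + 3 \<le> j" "j \<le> k"
        | j where "x = chord n 1 i j" "k \<le> j" "j \<le> i + int n - 2" "j \<noteq> k"
        unfolding double_fan_def by blast
      then show "x \<in> ?L"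
      proof cases
        case 1
        then show ?thesis using assms(2) unfolding double_fan_def by auto
      next
        case (2 j)
        then have "j \<le> k + 1" by simp
        then show ?thesis using 2 unfolding double_fan_def by blast
      next
        case (3 j)
        then have "k + 1 \<le> j" by simp
        then show ?thesis using 3 unfolding double_fan_def by blast
      qed
    qed
  qed
  moreover have "chord n 1 i k \<in> ?T" using assms(3) unfolding double_fan_def by blast
  moreover have "chord n 1 (i + 1) k \<in> ?T \<union> polygon_edges n"
  proof (cases "k = i + 2")
    case True
    then show ?thesis using chord_edge[of 1 n k "i + 1"] assms(1) by simp
  next
    case False
    then have "i + 3 \<le> k" using assms(2) by simp
    then show ?thesis unfolding double_fan_def by blast
  qed
  moreover have "chord n 1 i (k + 1) \<in> ?T \<union> polygon_edges n"
  proof (cases "k = i + int n - 2")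
    case True
    then have "chord n 1 i (k + 1) = chord n 1 (k + 1) (k + 2)"
      using chord_shift(1)[of n 1 "k + 1" i] by (simp add: chord_commute)
    then show ?thesis using chord_edge[of 1 n "k + 2" "k + 1"] assms(1) by simp
  next
    case False
    then have "k \<le> k + 1" "k + 1 \<le> i + int n - 2" using assms(3) by simp_all
    then show ?thesis unfolding double_fan_def by blast
  qed
  moreover have "chord n 1 i (i + 1) \<in> polygon_edges n" "chord n 1 k (k + 1) \<in> polygon_edges n"
    using chord_edge assms(1) by auto
  ultimately show ?thesis
    using chord_flip[of 1 i "i + 1" k "k + 1" n ?T] assms by auto
qed

text \<open>Both sides are the star at \<open>i + 1\<close>: the end of one round is the start of
  the next.\<close>

lemma double_fan_next: "double_fan n i (i + int n - 1) = double_fan n (i + 1) (i + 3)"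
  by (auto simp: double_fan_def add.commute)

lemma double_fan_shift: "double_fan n (i + int n) (k + int n) = double_fan n i k"
proof -
  have "chord n 1 (i + int n + 1) j = chord n 1 (i + 1) (j - int n)"
    "chord n 1 (i + int n) j = chord n 1 i (j - int n)" for j
    using chord_shift(1)[of n 1 "i + int n + 1" "j - int n"] chord_shift(2)[of n 1 "i + 1" "j - int n"]
      chord_shift(1)[of n 1 "i + int n" "j - int n"] chord_shift(2)[of n 1 i "j - int n"]
    by (simp_all add: add.assoc add.commute[of _ 1])
  note ch = this
  have "{chord n 1 (i + int n + 1) j | j. i + int n + 3 \<le> j \<and> j \<le> k + int n} =
      {chord n 1 (i + 1) j | j. i + 3 \<le> j \<and> j \<le> k}" (is "?A = ?B")
  proof
    show "?A \<subseteq> ?B" unfolding ch by force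
    show "?B \<subseteq> ?A"
    proof clarify
      fix j assume "i + 3 \<le> j" "j \<le> k"
      then show "\<exists>ja. chord n 1 (i + 1) j = chord n 1 (i + int n + 1) ja \<and> i + int n + 3 \<le> ja \<and> ja \<le> k + int n"
        by (intro exI[of _ "j + int n"]) (simp add: ch)
    qed
  qed
  moreover have "{chord n 1 (i + int n) j | j. k + int n \<le> j \<and> j \<le> i + int n + int n - 2} =
      {chord n 1 i j | j. k \<le> j \<and> j \<le> i + int n - 2}" (is "?A = ?B")
  proof
    show "?A \<subseteq> ?B" unfolding ch by force
    show "?B \<subseteq> ?A"
    proof clarify
      fix j assume "k \<le> j" "j \<le> i + int n - 2"
      then show "\<exists>ja. chord n 1 i j = chord n 1 (i + int n) ja \<and> k + int n \<le> ja \<and> ja \<le> i + int n + int n - 2"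
        by (intro exI[of _ "j + int n"]) (simp add: ch)
    qed
  qed
  ultimately show ?thesis unfolding double_fan_def by simp
qed

text \<open>A chord between positions at distance two cuts off an ear.\<close>

lemma double_fan_earsD:
  assumes "7 \<le> n" "i + 2 \<le> k" "k \<le> i + int n - 2" "chord n 1 x (x + 2) \<in> double_fan n i k"
  shows "int n dvd x - (i - 2) \<or> k = i + 2 \<and> int n dvd x - i \<or> i + 3 \<le> k \<and> int n dvd x - (i + 1)"
proof -
  have small: "y = 0 \<or> y = int n" if "int n dvd y" "0 \<le> y" "y \<le> int n" for y
    using that zdvd_not_zless[of y "int n"] by fastforce
  consider j where "chord n 1 x (x + 2) = chord n 1 (i + 1) j" "i + 3 \<le> j" "j \<le> k"
    | j where "chord n 1 x (x + 2) = chord n 1 i j" "k \<le> j" "j \<le> i + int n - 2"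
    using assms(4) unfolding double_fan_def by blast
  then show ?thesis
  proof cases
    case (1 j)
    then consider "int n dvd x - (i + 1)" | "int n dvd x - j" "int n dvd x + 2 - (i + 1)"
      using chord_eq_dvd_iff[of n 1] assms(1) by auto
    then show ?thesis
    proof cases
      case 1
      then show ?thesis using \<open>i + 3 \<le> j\<close> \<open>j \<le> k\<close> by simp
    next
      case 2
      \<comment> \<open>Matching the ends in reverse would make \<open>j + 1 - i\<close> a multiple
        of \<open>n\<close>, although it lies between \<open>4\<close> and
        \<open>n - 1\<close>.\<close>
      have "int n dvd (x + 2 - (i + 1)) - (x - j)" by (rule dvd_diff[OF 2(2,1)])
      then show ?thesis using small[of "j + 1 - i"] 1 assms by (simp add: algebra_simps)
    qed
  next
    case (2 j)
    then consider "int n dvd x - i" "int n dvd x + 2 - j" | "int n dvd x - j" "int n dvd x + 2 - i"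
      using chord_eq_dvd_iff[of n 1] assms(1) by auto
    then show ?thesis
    proof cases
      case 1
      have "int n dvd (x - i) - (x + 2 - j)" by (rule dvd_diff[OF 1])
      then have "j = i + 2" using small[of "j - i - 2"] 2 assms by (simp add: algebra_simps)
      then show ?thesis using 1 2 assms(2) by simp
    next
      case 2
      then show ?thesis by (simp add: algebra_simps)
    qed
  qed
qed

text \<open>Compare ears. If the ear with tip \<open>i - 1\<close> is not the corresponding ear of
  the other fan, matching the second ear as well forces \<open>n\<close> to divide a number between
  \<open>2\<close> and \<open>6\<close>, which \<open>7 \<le> n\<close> excludes.\<close>

lemma double_fan_eqD:
  assumes "7 \<le> n" "i + 2 \<le> k" "k \<le> i + int n - 2" "i' + 2 \<le> k'" "k' \<le> i' + int n - 2"
    and eq: "double_fan n i k = double_fan n i' k'"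
  shows "int n dvd i - i'"
proof -
  have mem1: "chord n 1 (i - 2) (i - 2 + 2) \<in> double_fan n i k"
  proof -
    have "chord n 1 (i - 2) i = chord n 1 i (i + int n - 2)"
      using chord_shift(2)[of n 1 "i - 2" i] by (simp add: chord_commute algebra_simps)
    then show ?thesis using assms(3) unfolding double_fan_def by auto
  qed
  have small: "\<not> int n dvd y" if "0 < \<bar>y\<bar>" "\<bar>y\<bar> < int n" for y
    using that zdvd_not_zless[of "\<bar>y\<bar>" "int n"] by auto
  \<comment> \<open>First end of the base of the second ear: its tip is \<open>i + 1\<close> when
    the fan is the star at \<open>i\<close>, and \<open>i + 2\<close> otherwise.\<close>
  define x where "x = (if k = i + 2 then i else i + 1)"
  have mem2: "chord n 1 x (x + 2) \<in> double_fan n i k"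
  proof (cases "k = i + 2")
    case True
    then have "x = i" "k \<le> i + 2" by (auto simp: x_def)
    then show ?thesis using assms(1) unfolding double_fan_def by auto
  next
    case False
    then have "x + 2 = i + 3" "x = i + 1" "i + 3 \<le> k" using assms(2) by (auto simp: x_def)
    then show ?thesis unfolding double_fan_def by auto
  qed
  note ears = double_fan_earsD[OF assms(1,4,5)]
  from ears[of "i - 2"] mem1 eq consider "int n dvd i - i'"
    | "k' = i' + 2" "int n dvd i - 2 - i'" | "i' + 3 \<le> k'" "int n dvd i - 2 - (i' + 1)"
    by auto
  then show ?thesis
  proof cases
    case 2
    from ears[of x] mem2 eq 2 have "int n dvd x - (i' - 2) \<or> int n dvd x - i'" by auto
    then have "int n dvd x - (i' - 2) - (i - 2 - i') \<or> int n dvd x - i' - (i - 2 - i')"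
      using dvd_diff 2(2) by blast
    then show ?thesis using small[of "x - i + 4"] small[of "x - i + 2"] assms(1)
      by (auto simp: x_def algebra_simps split: if_splits)
  next
    case 3
    from ears[of x] mem2 eq 3 have "int n dvd x - (i' - 2) \<or> int n dvd x - (i' + 1)" by auto
    then have "int n dvd x - (i' - 2) - (i - 2 - (i' + 1)) \<or> int n dvd x - (i' + 1) - (i - 2 - (i' + 1))"
      using dvd_diff 3(2) by blast
    then show ?thesis using small[of "x - i + 5"] small[of "x - i + 2"] assms(1)
      by (auto simp: x_def algebra_simps split: if_splits)
  qed
qed

text \<open>The chord from \<open>i\<close> to \<open>k\<close> leaves the fan when the apex moves
  past \<open>k\<close>.\<close>

lemma double_fan_apex_neq:
  assumes "7 \<le> n" "i + 2 \<le> k" "k < k'" "k' \<le> i + int n - 2"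
  shows "double_fan n i k \<noteq> double_fan n i k'"
proof
  assume eq: "double_fan n i k = double_fan n i k'"
  have "chord n 1 i k \<in> double_fan n i k" using assms unfolding double_fan_def by auto
  then have "chord n 1 i k \<in> double_fan n i k'" by (simp only: eq)
  then consider j where "chord n 1 i k = chord n 1 (i + 1) j" "i + 3 \<le> j" "j \<le> k'"
    | j where "chord n 1 i k = chord n 1 i j" "k' \<le> j" "j \<le> i + int n - 2"
    unfolding double_fan_def by (elim UnE CollectE exE conjE)
  then show False
  proof cases
    case (1 j)
    then show False using chord_eq_iff[of 1 i i n k "i + 1" j] assms by simp
  next
    case (2 j)
    then show False using chord_eq_iff[of 1 i i n k i j] assms by simp
  qed
qed

section \<open>Assembling the two-rainbow cycle\<close>

lemma count_list_map_upt: "count_list (map f [0..<m]) e = card {t. t < m \<and> f t = e}"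
proof -
  have "count_list (map f [0..<m]) e = length (filter (\<lambda>t. f t = e) [0..<m])"
    by (induction m) auto
  also have "\<dots> = card {t. t < m \<and> f t = e}"
    by (subst distinct_card[symmetric]) (auto intro: arg_cong[of _ _ card])
  finally show ?thesis .
qed

lemma two_rainbow_cycle:
  assumes n: "7 \<le> n"
  shows "\<exists>p. rainbow_cycle n 2 p"
proof -
  \<comment> \<open>A round of \<open>n - 3\<close> flips leads from the star at \<open>i\<close> to
    the star at \<open>i + 1\<close>. At time \<open>t\<close>, \<open>t div m\<close> is the round
    and \<open>t mod m\<close> the progress of the apex beyond \<open>i + 2\<close>.\<close>
  define m where "m = n - 3"
  have m: "0 < m" "int m = int n - 3" using n by (auto simp: m_def)
  define I where "I t = int (t div m)" for t
  define K where "K t = int (t div m) + 2 + int (t mod m)" for t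
  define f where "f t = double_fan n (I t) (K t)" for t
  define l where "l t = chord n 1 (I t + 1) (K t + 1)" for t
  define N where "N = n * m"
  have bnd: "I t + 2 \<le> K t" "K t \<le> I t + int n - 2" for t
    using m mod_less_divisor[OF m(1), of t] by (auto simp: I_def K_def)
  have f0: "f 0 = star n 1" by (auto simp: f_def I_def K_def double_fan_def star_def)
  have fN: "f N = f 0"
    using double_fan_shift[of n 0 2] m(1) by (simp add: f_def I_def K_def N_def add.commute)
  \<comment> \<open>At the end of a round \<open>K t + 1\<close> lies one step beyond the bound on
    \<open>K\<close>; \<open>double_fan_next\<close> reads this fan as the start of the next
    round.\<close>
  have fS: "f (Suc t) = double_fan n (I t) (K t + 1)" for t
  proof (cases "Suc (t mod m) = m")
    case True
    then have "Suc t div m = Suc (t div m)" "Suc t mod m = 0"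
      by (simp_all add: div_Suc mod_Suc)
    then have "I (Suc t) = I t + 1" "K (Suc t) = I t + 3" by (auto simp: I_def K_def)
    moreover have "K t + 1 = I t + int n - 1" using True m by (simp add: I_def K_def)
    ultimately show ?thesis by (simp only: f_def double_fan_next)
  next
    case False
    then have "Suc t div m = t div m" "Suc t mod m = Suc (t mod m)"
      by (simp_all add: div_Suc mod_Suc)
    then show ?thesis by (simp add: f_def I_def K_def add.commute add.left_commute)
  qed
  have flip: "is_flip n (f t) (chord n 1 (I t) (K t)) (l t) (f (Suc t))"
    if "f t \<in> triangulations n" for t
    using double_fan_flip[of n "I t" "K t"] bnd n that unfolding f_def[symmetric] fS l_def by (simp add: f_def)
  have tri: "f 0 \<in> triangulations n" using star_triangulation[of n 1] f0 n by simp
  have W: "flip_walk n (f 0) (steps f N) (f N)" "map flip_label (steps f N) = map l [0..<N]"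
    using flip_walk_steps[where f = f and m = N, OF tri flip] by blast+
  have inj: "inj_on f {0..<N}"
  proof (rule inj_onI)
    fix t t' assume t: "t \<in> {0..<N}" "t' \<in> {0..<N}" "f t = f t'"
    \<comment> \<open>The ears determine the round modulo \<open>n\<close>, and both rounds are
      below \<open>n\<close>; the apexes are then compared within the round.\<close>
    have "int n dvd I t - I t'" using double_fan_eqD[OF n bnd bnd] t(3) by (simp add: f_def)
    moreover have "t div m < n" "t' div m < n"
      using t m by (auto simp: N_def less_mult_imp_div_less)
    moreover from this have "\<bar>I t - I t'\<bar> < int n" by (simp add: I_def abs_less_iff)
    ultimately have I: "I t = I t'"
      using zdvd_not_zless[of "\<bar>I t - I t'\<bar>" "int n"] by fastforce
    moreover have "K t = K t'"
      using double_fan_apex_neq[OF n, of "I t" "K t" "K t'"] double_fan_apex_neq[OF n, of "I t" "K t'" "K t"]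
        t(3) bnd[of t] bnd[of t'] I by (simp add: f_def) (metis linorder_less_linear)
    ultimately have "t div m = t' div m" "t mod m = t' mod m" by (auto simp: I_def K_def)
    then show "t = t'" by (metis div_mult_mod_eq)
  qed
  have N0: "0 < N" using n m by (simp add: N_def)
  have dist: "distinct (map snd (steps f N))"
  proof -
    \<comment> \<open>The heads are \<open>f 1, ..., f N\<close>; as \<open>f N = f 0\<close>, they
      are a rotation of the first \<open>N\<close> vertices.\<close>
    have "map snd (steps f N) = map f [Suc 0..<Suc N]"
      unfolding map_snd_steps by (simp only: map_Suc_upt[symmetric] map_map comp_def)
    also have "\<dots> = map f [Suc 0..<N] @ [f 0]" using N0 fN by simp
    also have "distinct \<dots> \<longleftrightarrow> distinct (map f [0..<N])"
      using N0 by (auto simp: upt_conv_Cons)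
    also have "\<dots>" using inj by (simp add: distinct_map)
    finally show ?thesis .
  qed
  have cnt: "count_list (map flip_label (steps f N)) e = 2" if e: "e \<in> diagonals n" for e
  proof -
    have "2 \<le> n" using n by simp
    with e obtain x y where xy: "e = chord n 1 x y" "0 \<le> x" "x + 2 \<le> y" "y < int n"
      "\<not> (x = 0 \<and> y = int n - 1)"
      by (rule diagonal_is_chord)
    \<comment> \<open>The chord entering at time \<open>t\<close> joins \<open>I t + 1\<close> to
      \<open>K t + 1\<close>. Reaching \<open>x\<close> from \<open>y\<close> means arriving at
      position \<open>x + n\<close>, which fixes quotient and remainder.\<close>
    define t2 where "t2 = nat (y - 1) * m + nat (x + int n - y - 2)"
    have small: "z = 0 \<or> z = int n" if "int n dvd z" "0 \<le> z" "z \<le> int n" for z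
      using that zdvd_not_zless[of z "int n"] by fastforce
    \<comment> \<open>The diagonal \<open>xy\<close> is added once from \<open>x\<close> (at time \<open>t1\<close>) and once from \<open>y\<close> (at time \<open>t2\<close>).\<close>
    define P where "P = (if x = 0 then int n else x)"
    define t1 where "t1 = nat (P - 1) * m + nat (y - x - 2)"
    \<comment> \<open>The centres \<open>I t + 1\<close> run over \<open>1, ..., n\<close>, so
      position \<open>0\<close> occurs as \<open>n\<close>.\<close>
    have P: "1 \<le> P" "P \<le> int n" "P \<noteq> y" using xy by (auto simp: P_def)
    have lt: "nat (y - x - 2) < m" "nat (x + int n - y - 2) < m" using xy m by auto
    have dm1: "t1 div m = nat (P - 1)" "t1 mod m = nat (y - x - 2)"
      using lt(1) by (simp_all add: t1_def)
    have dm2: "t2 div m = nat (y - 1)" "t2 mod m = nat (x + int n - y - 2)"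
      using lt(2) by (simp_all add: t2_def)
    have "t1 < N" "t2 < N"
    proof -
      have "t1 div m < n" "t2 div m < n" using dm1 dm2 P xy by (simp_all add: nat_less_iff)
      then show "t1 < N" "t2 < N" using m(1) by (simp_all add: N_def div_less_iff_less_mult)
    qed
    moreover have "l t1 = e"
    proof -
      have "l t1 = chord n 1 P (P + (y - x))"
        using P xy dm1 by (simp add: l_def I_def K_def algebra_simps)
      then show ?thesis
        using xy(1) chord_shift(1)[of n 1 "int n" y] chord_shift(2)[of n 1 0 y]
        by (auto simp: P_def add.commute)
    qed
    moreover have "l t2 = e"
    proof -
      have "y + 2 \<le> x + int n" using xy by linarith
      then have "l t2 = chord n 1 y (x + int n)"
        using xy dm2 by (simp add: l_def I_def K_def algebra_simps)
      then show ?thesis using xy(1) chord_shift(1) chord_commute by metis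
    qed
    moreover have "t = t1 \<or> t = t2" if t: "t < N" "l t = e" for t
    proof -
      have tn: "t div m < n" using t(1) by (simp add: N_def less_mult_imp_div_less)
      have Kt: "K t = I t + 2 + int (t mod m)" by (simp add: I_def K_def)
      have p: "1 \<le> I t + 1" "I t + 1 \<le> int n" using tn by (auto simp: I_def)
      \<comment> \<open>The two matchings of the ends give \<open>t1\<close> and \<open>t2\<close>:
        subtracting the congruences determines the remainder of \<open>t\<close>, and the one for
        \<open>I t + 1\<close> the quotient.\<close>
      from t(2) xy(1) consider "int n dvd I t + 1 - x" "int n dvd K t + 1 - y"
        | "int n dvd I t + 1 - y" "int n dvd K t + 1 - x"
        using chord_eq_dvd_iff[of n 1] n by (auto simp: l_def)
      then show ?thesis
      proof cases
        case 1
        have "int n dvd (K t + 1 - y) - (I t + 1 - x)" by (rule dvd_diff[OF 1(2,1)])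
        then have "int n dvd \<bar>K t - I t - (y - x)\<bar>" by (simp add: algebra_simps)
        then have "K t - I t = y - x" using small bnd[of t] xy by fastforce
        then have md: "t mod m = nat (y - x - 2)" using Kt by auto
        have "int n dvd \<bar>I t + 1 - x\<bar>" using 1 by simp
        then have "\<bar>I t + 1 - x\<bar> = 0 \<or> \<bar>I t + 1 - x\<bar> = int n"
          by (rule small) (use p xy in auto)
        then have "I t + 1 = P" using p xy by (auto simp: P_def)
        then have "t div m = nat (P - 1)" by (auto simp: I_def)
        then have "t = t1" using md t1_def div_mult_mod_eq[of t m] by simp
        then show ?thesis ..
      next
        case 2
        have "int n dvd (K t + 1 - x) - (I t + 1 - y) - int n"
          by (rule dvd_diff[OF dvd_diff[OF 2(2,1)] dvd_refl])
        then have "int n dvd \<bar>K t - I t + y - x - int n\<bar>" by (simp add: algebra_simps)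
        then have "K t - I t = x + int n - y" using small bnd[of t] xy by fastforce
        then have md: "t mod m = nat (x + int n - y - 2)" using Kt by auto
        have "int n dvd \<bar>I t + 1 - y\<bar>" using 2 by simp
        then have "\<bar>I t + 1 - y\<bar> = 0 \<or> \<bar>I t + 1 - y\<bar> = int n"
          by (rule small) (use p xy in auto)
        then have "I t + 1 = y" using p xy by auto
        then have "t div m = nat (y - 1)" by (auto simp: I_def)
        then have "t = t2" using md t2_def div_mult_mod_eq[of t m] by simp
        then show ?thesis ..
      qed
    qed
    ultimately have "{t. t < N \<and> l t = e} = {t1, t2}" by blast
    moreover have "t1 \<noteq> t2" using dm1(1) dm2(1) P xy by auto
    ultimately show ?thesis unfolding W(2) count_list_map_upt by simp
  qed
  have "steps f N \<noteq> []" using N0 by (simp add: steps_def)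
  with W(1) dist cnt show ?thesis unfolding fN using rainbow_cycleI by blast
qed

subsection \<open>The one-rainbow cycle\<close>

text \<open>Fans are kept as sets of index pairs. On \<open>ordered_pairs\<close> the passage to
  chords is injective, so membership, exchange and disjointness reduce to integer arithmetic in both
  orientations.\<close>

definition chords :: "nat \<Rightarrow> int \<Rightarrow> (int \<times> int) set \<Rightarrow> nat set set" where
  "chords n s P = (\<lambda>(i, j). chord n s i j) ` P"

definition ordered_pairs :: "nat \<Rightarrow> (int \<times> int) set" where
  "ordered_pairs n = {(i, j). 0 \<le> i \<and> i < j \<and> j < int n}"

lemma inj_on_chord:
  assumes "\<bar>s\<bar> = 1"
  shows "inj_on (\<lambda>(i, j). chord n s i j) (ordered_pairs n)"
proof (rule inj_onI, clarify)
  fix i j k l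
  assume "(i, j) \<in> ordered_pairs n" "(k, l) \<in> ordered_pairs n" "chord n s i j = chord n s k l"
  then show "i = k \<and> j = l"
    using chord_eq_iff[of s 0 i n j k l] assms by (auto simp: ordered_pairs_def)
qed

lemma chord_in_chords_iff:
  assumes "\<bar>s\<bar> = 1" "(i, j) \<in> ordered_pairs n" "P \<subseteq> ordered_pairs n"
  shows "chord n s i j \<in> chords n s P \<longleftrightarrow> (i, j) \<in> P"
  using inj_on_image_mem_iff[OF inj_on_chord[OF assms(1)] assms(2,3)] by (simp add: chords_def)

lemma chords_exchange:
  assumes "\<bar>s\<bar> = 1" "(i, j) \<in> ordered_pairs n" "P \<subseteq> ordered_pairs n" "P' = insert (k, l) (P - {(i, j)})"
  shows "chords n s P' = insert (chord n s k l) (chords n s P - {chord n s i j})"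
  using inj_on_image_set_diff[OF inj_on_chord[OF assms(1), of n], of P "{(i, j)}"] assms(2,3)
  by (simp add: chords_def assms(4) subset_iff)

lemma chords_disjoint:
  assumes "\<bar>s\<bar> = 1" "P \<subseteq> ordered_pairs n" "Q \<subseteq> ordered_pairs n" "P \<inter> Q = {}"
  shows "chords n s P \<inter> chords n s Q = {}"
  using inj_on_image_Int[OF inj_on_chord[OF assms(1)] assms(2,3)] assms(4) by (simp add: chords_def)

text \<open>The reflection fixing position \<open>0\<close>, an involution on
  \<open>ordered_pairs\<close>. The swap and the special case for \<open>0\<close> keep the pairs
  ordered with entries below \<open>n\<close>.\<close>

definition mirror :: "nat \<Rightarrow> int \<times> int \<Rightarrow> int \<times> int" where
  "mirror n = (\<lambda>(i, j). if i = 0 then (0, int n - j) else (int n - j, int n - i))"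

lemma chord_minus: "chord n (- s) (int n - i) (int n - j) = chord n s i j"
  "chord n (- s) 0 (int n - j) = chord n s 0 j"
  using vx_shift[of n "- s" "- i"] vx_shift[of n "- s" "- j"] by (simp_all add: chord_def vx_minus)

text \<open>Reversing the orientation has the same effect as reflecting the indices; this carries
  the smaller return walk back to the original orientation.\<close>

lemma chords_minus: "chords n (- s) P = chords n s (mirror n ` P)"
proof -
  have "(case p of (i, j) \<Rightarrow> chord n (- s) i j) = (case mirror n p of (i, j) \<Rightarrow> chord n s i j)" for p
  proof (cases p)
    case (Pair i j)
    then show ?thesis
      using chord_minus(1)[of n s "int n - i" "int n - j"] chord_minus(2)[of n s "int n - j"]
      by (auto simp: mirror_def chord_commute)
  qed
  then show ?thesis by (simp add: chords_def image_image)
qed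

text \<open>In the subpolygon \<open>0, lo, ..., h\<close>, \<open>fan_hi\<close> is the star at \<open>h\<close> and \<open>fan_lo\<close> the star at \<open>lo\<close>;
  \<open>fan_mid\<close> interpolates between \<open>fan_hi n lo h\<close> and \<open>fan_lo n lo (h - 1)\<close>.\<close>

definition spokes :: "nat \<Rightarrow> int \<Rightarrow> int \<Rightarrow> (int \<times> int) set" where
  "spokes n lo h = {(0, j) | j. 2 \<le> j \<and> j \<le> int n - 2 \<and> (j \<le> lo \<or> h \<le> j)}"

definition fan_hi :: "nat \<Rightarrow> int \<Rightarrow> int \<Rightarrow> (int \<times> int) set" where
  "fan_hi n lo h = {(i, h) | i. lo \<le> i \<and> i \<le> h - 2} \<union> spokes n lo h"

definition fan_lo :: "nat \<Rightarrow> int \<Rightarrow> int \<Rightarrow> (int \<times> int) set" where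
  "fan_lo n lo h = {(lo, j) | j. lo + 2 \<le> j \<and> j \<le> h} \<union> spokes n lo h"

definition fan_mid :: "nat \<Rightarrow> int \<Rightarrow> int \<Rightarrow> int \<Rightarrow> (int \<times> int) set" where
  "fan_mid n lo h m = {(lo, j) | j. lo + 2 \<le> j \<and> j \<le> m} \<union>
     {(i, h) | i. i = lo \<or> m \<le> i \<and> i \<le> h - 2} \<union> spokes n lo h"

lemmas fan_defs = fan_hi_def fan_lo_def fan_mid_def spokes_def

lemma fan_ordered_pairs:
  assumes "1 \<le> lo" "lo < h" "h \<le> int n - 1"
  shows "fan_hi n lo h \<subseteq> ordered_pairs n" "fan_lo n lo h \<subseteq> ordered_pairs n"
    "1 \<le> m \<Longrightarrow> m < h \<Longrightarrow> fan_mid n lo h m \<subseteq> ordered_pairs n"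
  using assms by (auto simp: fan_defs ordered_pairs_def)

text \<open>For \<open>lo = h - 1\<close> the subpolygon is the triangle \<open>0, h - 1, h\<close>,
  and only spokes remain.\<close>

lemma star_eq_fan_hi: "star n s = chords n s (fan_hi n (h - 1) h)"
  by (force simp: star_def chords_def fan_defs)

text \<open>The reflection exchanges the roles of the two neighbours of \<open>0\<close> in the
  subpolygon. The detour uses this to enter the smaller return walk at its start.\<close>

lemma mirror_fan_hi:
  assumes "1 \<le> lo" "h \<le> int n - 1"
  shows "mirror n ` fan_hi n (int n - h) (int n - lo) = fan_lo n lo h"
proof
  show "mirror n ` fan_hi n (int n - h) (int n - lo) \<subseteq> fan_lo n lo h"
    using assms by (auto simp: mirror_def fan_defs)
  show "fan_lo n lo h \<subseteq> mirror n ` fan_hi n (int n - h) (int n - lo)"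
  proof
    fix p assume p: "p \<in> fan_lo n lo h"
    then have "mirror n p \<in> fan_hi n (int n - h) (int n - lo)" "p = mirror n (mirror n p)"
      using assms by (auto simp: mirror_def fan_defs)
    then show "p \<in> mirror n ` fan_hi n (int n - h) (int n - lo)" by blast
  qed
qed

lemma edge_or_chord:
  assumes "\<bar>s\<bar> = 1" "0 < n" "j = i + 1 \<or> (i, j) \<in> P \<or> i = 0 \<and> j = int n - 1"
  shows "chord n s i j \<in> chords n s P \<union> polygon_edges n"
proof -
  have "chord n s 0 (int n - 1) = chord n s (int n - 1) (int n)"
    using chord_shift(1)[of n s "int n - 1" 0] by (simp add: chord_commute)
  then have "chord n s 0 (int n - 1) \<in> polygon_edges n"
    using chord_edge[OF assms(1,2), of "int n" "int n - 1"] by simp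
  then show ?thesis
    using chord_edge[OF assms(1,2)] assms(3) by (auto simp: chords_def)
qed

section \<open>Flips between fans of a subpolygon\<close>

lemma fan_hi_flip:
  assumes s: "\<bar>s\<bar> = 1" and m: "2 \<le> m" "m < h" "h \<le> int n - 1"
    and T: "chords n s (fan_hi n m h) \<in> triangulations n"
  shows "is_flip n (chords n s (fan_hi n m h)) (chord n s 0 m) (chord n s (m - 1) h)
    (chords n s (fan_hi n (m - 1) h))"
proof -
  \<comment> \<open>The quadrilateral is \<open>0, m - 1, m, h\<close>: a spoke gives way to a chord
    at \<open>h\<close>.\<close>
  have mem: "(0, m) \<in> fan_hi n m h" using m by (auto simp: fan_defs)
  have ex: "fan_hi n (m - 1) h = insert (m - 1, h) (fan_hi n m h - {(0, m)})"
    using m by (auto simp: fan_defs)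
  have op: "(0, m) \<in> ordered_pairs n" "fan_hi n m h \<subseteq> ordered_pairs n"
    using m fan_ordered_pairs(1)[of m h n] by (auto simp: ordered_pairs_def)
  have n: "0 < n" using m by auto
  have "chord n s 0 (m - 1) \<in> chords n s (fan_hi n m h) \<union> polygon_edges n"
    "chord n s (m - 1) m \<in> chords n s (fan_hi n m h) \<union> polygon_edges n"
    "chord n s m h \<in> chords n s (fan_hi n m h) \<union> polygon_edges n"
    "chord n s 0 h \<in> chords n s (fan_hi n m h) \<union> polygon_edges n"
    by (rule edge_or_chord[OF s n]; use m in \<open>auto simp: fan_defs\<close>)+
  then show ?thesis
    unfolding chords_exchange[OF s op ex]
    using chord_flip[OF s _ _ _ _ T, of 0 "m - 1" m h] m chord_in_chords_iff[OF s op] mem by auto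
qed

text \<open>In the quadrilateral \<open>lo, m, m + 1, h\<close> a chord at \<open>h\<close> gives
  way to one at \<open>lo\<close>. Counted cyclically from \<open>m\<close>, the corner
  \<open>lo\<close> comes last, as position \<open>lo + n\<close>.\<close>

lemma fan_mid_flip:
  assumes s: "\<bar>s\<bar> = 1" and lo: "1 \<le> lo" "lo + 1 \<le> m" "m \<le> h - 2" "h \<le> int n - 1"
    and T: "chords n s (fan_mid n lo h m) \<in> triangulations n"
  shows "is_flip n (chords n s (fan_mid n lo h m)) (chord n s m h) (chord n s lo (m + 1))
    (chords n s (fan_mid n lo h (m + 1)))"
proof -
  have mem: "(m, h) \<in> fan_mid n lo h m" using lo by (auto simp: fan_defs)
  have ex: "fan_mid n lo h (m + 1) = insert (lo, m + 1) (fan_mid n lo h m - {(m, h)})"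
    using lo by (auto simp: fan_defs)
  have op: "(m, h) \<in> ordered_pairs n" "fan_mid n lo h m \<subseteq> ordered_pairs n"
    using lo fan_ordered_pairs(3)[of lo h n m] by (auto simp: ordered_pairs_def)
  have n: "0 < n" using lo by auto
  have "chord n s m (m + 1) \<in> chords n s (fan_mid n lo h m) \<union> polygon_edges n"
    "chord n s (m + 1) h \<in> chords n s (fan_mid n lo h m) \<union> polygon_edges n"
    "chord n s lo h \<in> chords n s (fan_mid n lo h m) \<union> polygon_edges n"
    "chord n s lo m \<in> chords n s (fan_mid n lo h m) \<union> polygon_edges n"
    by (rule edge_or_chord[OF s n]; use lo in \<open>auto simp: fan_defs\<close>)+
  then show ?thesis
    unfolding chords_exchange[OF s op ex]
    using chord_flip[OF s _ _ _ _ T, of m "m + 1" h "lo + int n"] lo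
      chord_in_chords_iff[OF s op] mem
    by (simp add: chord_shift chord_commute[of n s _ lo])
qed

text \<open>In the quadrilateral \<open>0, lo, h - 1, h\<close> the last inner chord at
  \<open>h\<close> is removed. The new spoke cuts off \<open>h\<close> and leaves the subpolygon
  ending at \<open>h - 1\<close>.\<close>

lemma fan_mid_flip_last:
  assumes s: "\<bar>s\<bar> = 1" and lo: "1 \<le> lo" "lo + 3 \<le> h" "h \<le> int n - 1"
    and T: "chords n s (fan_mid n lo h (h - 1)) \<in> triangulations n"
  shows "is_flip n (chords n s (fan_mid n lo h (h - 1))) (chord n s lo h) (chord n s 0 (h - 1))
    (chords n s (fan_lo n lo (h - 1)))"
proof -
  let ?P = "fan_mid n lo h (h - 1)"
  have mem: "(lo, h) \<in> ?P" using lo by (auto simp: fan_defs)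
  have ex: "fan_lo n lo (h - 1) = insert (0, h - 1) (?P - {(lo, h)})"
    using lo by (auto simp: fan_defs)
  have op: "(lo, h) \<in> ordered_pairs n" "?P \<subseteq> ordered_pairs n"
    using lo fan_ordered_pairs(3)[of lo h n "h - 1"] by (auto simp: ordered_pairs_def)
  have n: "0 < n" using lo by auto
  have sides: "chord n s lo (h - 1) \<in> chords n s ?P \<union> polygon_edges n"
    "chord n s (h - 1) h \<in> chords n s ?P \<union> polygon_edges n"
    "chord n s 0 h \<in> chords n s ?P \<union> polygon_edges n"
    "chord n s 0 lo \<in> chords n s ?P \<union> polygon_edges n"
    by (rule edge_or_chord[OF s n]; use lo in \<open>auto simp: fan_defs\<close>)+
  have "chord n s x (int n) = chord n s 0 x" for x
    using chord_shift(1)[of n s x 0] by (simp add: chord_commute)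
  then show ?thesis
    unfolding chords_exchange[OF s op ex]
    using chord_flip[OF s _ _ _ _ T, of lo "h - 1" h "int n"] lo sides
      chord_in_chords_iff[OF s op] mem
    by simp
qed

text \<open>A return walk closes up the walk \<open>fan_hi n (h - 1) h, ..., fan_hi n lo h\<close> from the star at \<open>0\<close>
  to the star at \<open>h\<close> to a cycle in which each diagonal of the subpolygon \<open>0, lo, ..., h\<close> is added
  once. Keeping all outer spokes is what separates its vertices from those of the next detour.\<close>

definition return_labels :: "int \<Rightarrow> int \<Rightarrow> (int \<times> int) set" where
  "return_labels lo h = {(0, j) | j. lo < j \<and> j < h} \<union> {(i, j). lo \<le> i \<and> i + 2 \<le> j \<and> j < h}"

definition return_walk :: "nat \<Rightarrow> int \<Rightarrow> int \<Rightarrow> int \<Rightarrow> (nat set set \<times> nat set set) list \<Rightarrow> bool" where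
  "return_walk n s lo h q \<longleftrightarrow>
     flip_walk n (chords n s (fan_hi n lo h)) q (star n s) \<and>
     distinct (map snd q) \<and>
     (\<forall>T \<in> set (map snd q). \<forall>m. lo \<le> m \<and> m < h - 1 \<longrightarrow> T \<noteq> chords n s (fan_hi n m h)) \<and>
     (\<forall>T \<in> set (map snd q). chords n s (spokes n lo h) \<subseteq> T) \<and>
     distinct (map flip_label q) \<and>
     set (map flip_label q) = chords n s (return_labels lo h)"

text \<open>The subpolygon is the quadrilateral \<open>0, lo, lo + 1, h\<close> with its two
  triangulations; the return walk reverses the single flip between them.\<close>

lemma return_walk_base:
  assumes s: "\<bar>s\<bar> = 1" and lo: "1 \<le> lo" "h = lo + 2" "h \<le> int n - 1" and n: "4 \<le> n"
  shows "return_walk n s lo h [(chords n s (fan_hi n lo h), star n s)]"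
proof -
  let ?F = "chords n s (fan_hi n lo h)"
  have "star n s = chords n s (fan_hi n (lo + 1) h)"
    using star_eq_fan_hi[of n s h] lo by (simp add: algebra_simps)
  then have "is_flip n (star n s) (chord n s 0 (lo + 1)) (chord n s lo h) ?F"
    using fan_hi_flip[OF s, of "lo + 1" h n] lo star_triangulation[OF n s] by simp
  then have fl: "is_flip n ?F (chord n s lo h) (chord n s 0 (lo + 1)) (star n s)"
    by (simp add: is_flip_iff)
  define f where "f i = (if i = 0 then ?F else star n s)" for i :: nat
  have "f 0 \<in> triangulations n" using fl by (simp add: f_def is_flip_iff)
  then have W: "flip_walk n ?F [(?F, star n s)] (star n s)"
    using flip_walk_steps(1)[of f n 1 "\<lambda>_. chord n s lo h" "\<lambda>_. chord n s 0 (lo + 1)"] fl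
    by (simp add: f_def steps_def)
  \<comment> \<open>The remaining value \<open>m = h - 1\<close> is the star itself, where the walk
    is meant to end.\<close>
  have ne: "star n s \<noteq> chords n s (fan_hi n m h)" if "lo \<le> m" "m < h - 1" for m
  proof -
    have "m = lo" using that lo by simp
    then show ?thesis using fl by (auto simp: is_flip_iff)
  qed
  have "chords n s (spokes n lo h) \<subseteq> star n s"
    by (auto simp: star_def chords_def spokes_def)
  moreover have "return_labels lo h = {(0, lo + 1)}"
    using lo by (auto simp: return_labels_def)
  ultimately show ?thesis
    using W ne flip_label_eq[OF fl] by (simp add: return_walk_def chords_def)
qed

text \<open>The detour runs from the star at \<open>h\<close> through \<open>fan_mid\<close> to the
  star at \<open>lo\<close> of the subpolygon ending at \<open>h - 1\<close>, then along
  \<open>q\<close>, in whose mirrored coordinates this star is a \<open>fan_hi\<close>. Everything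
  on \<open>q\<close> contains the spoke to \<open>h - 1\<close>, which the fans before the last new
  flip lack.\<close>

lemma return_walk_step:
  assumes s: "\<bar>s\<bar> = 1" and lo: "1 \<le> lo" "lo + 3 \<le> h" "h \<le> int n - 1"
    and q: "return_walk n (- s) (int n - (h - 1)) (int n - lo) q"
    and T0: "chords n s (fan_hi n lo h) \<in> triangulations n"
  shows "\<exists>q. return_walk n s lo h q"
proof -
  define M where "M = nat (h - 2 - lo)"
  have M: "int M = h - 2 - lo" "1 \<le> M" using lo by (auto simp: M_def)
  \<comment> \<open>Index \<open>0\<close> is the star at \<open>h\<close>, since
    \<open>fan_mid\<close> at \<open>lo + 1\<close> has no new chord yet; at index \<open>M\<close>
    only \<open>(lo, h)\<close> is left for the final flip.\<close>
  define P where "P i = (if i \<le> M then fan_mid n lo h (lo + 1 + int i) else fan_lo n lo (h - 1))" for i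
  define f where "f i = chords n s (P i)" for i
  define r where "r i = (if i < M then (lo, lo + 2 + int i) else (0, h - 1))" for i
  define l where "l i = (case r i of (i, j) \<Rightarrow> chord n s i j)" for i
  define e where "e i = (if i < M then chord n s (lo + 1 + int i) h else chord n s lo h)" for i
  have P_sub: "P i \<subseteq> ordered_pairs n" for i
    using fan_ordered_pairs(2)[of lo "h - 1" n] fan_ordered_pairs(3)[of lo h n "lo + 1 + int i"] lo M
    by (auto simp: P_def)
  have r_sub: "r i \<in> ordered_pairs n" for i
    using lo M by (auto simp: r_def ordered_pairs_def)
  have f0: "f 0 = chords n s (fan_hi n lo h)"
    using lo M by (auto simp: f_def P_def fan_defs intro!: arg_cong[of _ _ "chords n s"])
  have flip: "is_flip n (f i) (e i) (l i) (f (Suc i))" if i: "i < Suc M" "f i \<in> triangulations n" for i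
  proof (cases "i < M")
    case True
    then show ?thesis
      using fan_mid_flip[OF s, of lo "lo + 1 + int i" h n] lo M i(2)
      by (simp add: f_def P_def e_def l_def r_def algebra_simps)
  next
    case False
    then have iM: "i = M" and "lo + 1 + int M = h - 1" using i M by auto
    then have "f i = chords n s (fan_mid n lo h (h - 1))"
      by (simp only: f_def P_def order_refl if_True)
    then show ?thesis
      using fan_mid_flip_last[OF s lo] i(2) iM by (simp add: P_def e_def l_def r_def f_def[of "Suc _"])
  qed
  have W: "flip_walk n (f 0) (steps f (Suc M)) (f (Suc M))"
    "map flip_label (steps f (Suc M)) = map l [0..<Suc M]"
    using flip_walk_steps[where f = f and m = "Suc M", OF T0[folded f0] flip] by blast+
  have old: "flip_walk n (chords n (- s) (fan_hi n (int n - (h - 1)) (int n - lo))) q (star n (- s))"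
    "distinct (map snd q)"
    "\<forall>T \<in> set (map snd q). \<forall>m. int n - (h - 1) \<le> m \<and> m < int n - lo - 1 \<longrightarrow>
       T \<noteq> chords n (- s) (fan_hi n m (int n - lo))"
    "\<forall>T \<in> set (map snd q). chords n (- s) (spokes n (int n - (h - 1)) (int n - lo)) \<subseteq> T"
    "distinct (map flip_label q)"
    "set (map flip_label q) = chords n (- s) (return_labels (int n - (h - 1)) (int n - lo))"
    using q unfolding return_walk_def by blast+
  have mirrored: "chords n (- s) (fan_hi n (int n - (h - 1)) (int n - lo)) = f (Suc M)"
    using mirror_fan_hi[of lo "h - 1" n] lo by (simp add: chords_minus f_def P_def)
  have walk: "flip_walk n (chords n s (fan_hi n lo h)) (steps f (Suc M) @ q) (star n s)"
    using flip_walk_append[OF W(1)] old(1) unfolding mirrored star_minus f0 by blast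
  have q_spokes: "chord n s 0 j \<in> T"
    if "T \<in> set (map snd q)" "2 \<le> j" "j \<le> int n - 2" "j \<le> lo \<or> h - 1 \<le> j" for T j
  proof -
    have "(0, int n - j) \<in> spokes n (int n - (h - 1)) (int n - lo)"
      using that by (auto simp: spokes_def)
    then have "chord n (- s) 0 (int n - j) \<in> T" using old(4) that(1) unfolding chords_def by fastforce
    then show ?thesis by (simp add: chord_minus)
  qed
  have q_mem: "chord n s 0 (h - 1) \<in> T" if "T \<in> set (map snd q)" for T
    using q_spokes[OF that] lo by simp
  have f_mem: "chord n s i j \<in> f k \<longleftrightarrow> (i, j) \<in> P k" if "(i, j) \<in> ordered_pairs n" for i j k
    unfolding f_def by (rule chord_in_chords_iff[OF s that P_sub])
  have op: "(0, h - 1) \<in> ordered_pairs n" using lo by (simp add: ordered_pairs_def)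
  have f_not_mem: "chord n s 0 (h - 1) \<notin> f k" if "k \<le> M" for k
    using f_mem[OF op, of k] that lo by (auto simp: P_def fan_defs)
  have f_last: "chord n s 0 (h - 1) \<in> f (Suc M)"
    using f_mem[OF op, of "Suc M"] lo by (auto simp: P_def fan_defs)
  have vnew: "set (map snd (steps f (Suc M))) = f ` {1..Suc M}"
  proof -
    have "set (map snd (steps f (Suc M))) = f ` Suc ` {0..<Suc M}"
      by (simp only: map_snd_steps set_map set_upt image_image)
    then show ?thesis
      by (simp only: image_Suc_atLeastAtMost atLeastLessThanSuc_atLeastAtMost One_nat_def)
  qed
  have f_ne: "f i \<noteq> f j" if "1 \<le> i" "i < j" "j \<le> Suc M" for i j
  proof (cases "j \<le> M")
    case True
    \<comment> \<open>The chord from \<open>lo\<close> to \<open>lo + 1 + j\<close> first appears at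
      index \<open>j\<close>.\<close>
    have "(lo, lo + 1 + int j) \<in> ordered_pairs n" using True lo M by (auto simp: ordered_pairs_def)
    then have "chord n s lo (lo + 1 + int j) \<in> f j" "chord n s lo (lo + 1 + int j) \<notin> f i"
      using f_mem True that lo M by (auto simp: P_def fan_defs)
    then show ?thesis by blast
  next
    case False
    then have "j = Suc M" "i \<le> M" using that by auto
    then show ?thesis using f_last f_not_mem by blast
  qed
  have dist_v: "distinct (map snd (steps f (Suc M) @ q))"
  proof -
    have "inj_on (\<lambda>i. f (Suc i)) {0..<Suc M}"
      by (rule linorder_inj_onI') (use f_ne in auto)
    then have "distinct (map snd (steps f (Suc M)))"
      by (simp only: map_snd_steps distinct_map set_upt distinct_upt simp_thms)
    moreover have "T \<notin> set (map snd q)" if "T \<in> f ` {1..Suc M}" for T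
    proof
      assume T: "T \<in> set (map snd q)"
      obtain i where i: "T = f i" "1 \<le> i" "i \<le> Suc M" using \<open>T \<in> f ` {1..Suc M}\<close> by auto
      show False
      proof (cases "i \<le> M")
        case True
        then show False using q_mem[OF T] f_not_mem i by blast
      next
        case False
        then have "T = f (Suc M)" using i by (simp add: le_Suc_eq)
        \<comment> \<open>This fan is the start of \<open>q\<close>. That \<open>q\<close> does not
          return to it is the mirrored avoidance condition with \<open>m\<close> at its lower
          bound.\<close>
        then show False using old(3) T mirrored lo by fastforce
      qed
    qed
    ultimately show ?thesis using old(2) vnew by (auto simp: image_iff)
  qed
  \<comment> \<open>Each head on the new walk has a chord that \<open>fan_hi n m h\<close> lacks:
    the spoke to \<open>h - 1\<close>, or a chord from \<open>lo\<close> to a position between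
    \<open>lo + 2\<close> and \<open>h - 1\<close>.\<close>
  have avoid: "T \<noteq> chords n s (fan_hi n m h)"
    if T: "T \<in> set (map snd (steps f (Suc M) @ q))" and m: "lo \<le> m" "m < h - 1" for T m
  proof -
    let ?H = "chords n s (fan_hi n m h)"
    have mem_H: "chord n s i j \<in> ?H \<longleftrightarrow> (i, j) \<in> fan_hi n m h" if "(i, j) \<in> ordered_pairs n" for i j
      using chord_in_chords_iff[OF s that fan_ordered_pairs(1)] lo m by simp
    have H: "chord n s 0 (h - 1) \<notin> ?H" using mem_H[OF op] m lo by (auto simp: fan_defs)
    from T consider "T \<in> set (map snd q)" | i where "1 \<le> i" "i \<le> M" "T = f i" | "T = f (Suc M)"
      using vnew by (auto simp: le_Suc_eq)
    then show ?thesis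
    proof cases
      case 1
      then show ?thesis using q_mem H by blast
    next
      case (2 i)
      have lp: "(lo, lo + 1 + int i) \<in> ordered_pairs n" using 2 lo M by (auto simp: ordered_pairs_def)
      have "chord n s lo (lo + 1 + int i) \<in> f i" using f_mem[OF lp] 2 lo M by (auto simp: P_def fan_defs)
      moreover have "chord n s lo (lo + 1 + int i) \<notin> ?H"
        using mem_H[OF lp] 2 lo M m by (auto simp: fan_defs)
      ultimately show ?thesis using 2 by blast
    next
      case 3
      then show ?thesis using f_last H by blast
    qed
  qed
  have contain: "chords n s (spokes n lo h) \<subseteq> T" if T: "T \<in> set (map snd (steps f (Suc M) @ q))" for T
  proof -
    from T have "T \<in> f ` {1..Suc M} \<or> T \<in> set (map snd q)"
      by (simp only: map_append set_append vnew Un_iff)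
    then consider "T \<in> set (map snd q)" | i where "T = f i" by blast
    then show ?thesis
    proof cases
      case 1
      show ?thesis
      proof
        fix x assume "x \<in> chords n s (spokes n lo h)"
        then obtain j where "x = chord n s 0 j" "2 \<le> j" "j \<le> int n - 2" "j \<le> lo \<or> h \<le> j"
          by (auto simp: chords_def spokes_def)
        then show "x \<in> T" using q_spokes[OF 1, of j] by auto
      qed
    next
      case (2 i)
      have "spokes n lo h \<subseteq> P i" by (auto simp: P_def fan_defs)
      then show ?thesis using 2 by (auto simp: f_def chords_def)
    qed
  qed
  let ?R = "mirror n ` return_labels (int n - (h - 1)) (int n - lo)"
  \<comment> \<open>In the original orientation \<open>q\<close> adds the diagonals of the
    subpolygon ending at \<open>h - 1\<close> that avoid \<open>lo\<close>. The new part supplies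
    those at \<open>lo\<close> and the spoke to \<open>h - 1\<close>.\<close>
  have R: "?R = {(0, j) | j. lo < j \<and> j < h - 1} \<union> {(i, j). lo < i \<and> i + 2 \<le> j \<and> j < h}" (is "_ = ?R'")
  proof
    show "?R \<subseteq> ?R'" using lo by (auto simp: mirror_def return_labels_def)
    show "?R' \<subseteq> ?R"
    proof
      fix p assume "p \<in> ?R'"
      then have "mirror n p \<in> return_labels (int n - (h - 1)) (int n - lo)" "p = mirror n (mirror n p)"
        using lo by (auto simp: mirror_def return_labels_def)
      then show "p \<in> ?R" by blast
    qed
  qed
  have lab_old: "set (map flip_label q) = chords n s ?R'"
    using old(6) unfolding chords_minus R .
  have lab_new: "set (map flip_label (steps f (Suc M))) = chords n s (r ` {0..<Suc M})"
    unfolding W(2) by (simp only: l_def[abs_def] chords_def set_map set_upt image_image)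
  have r_img: "r ` {0..<Suc M} = {(lo, j) | j. lo + 2 \<le> j \<and> j < h} \<union> {(0, h - 1)}" (is "_ = ?N")
  proof
    show "r ` {0..<Suc M} \<subseteq> ?N" using M by (auto simp: r_def)
    show "?N \<subseteq> r ` {0..<Suc M}"
    proof
      fix p assume "p \<in> ?N"
      then consider j where "p = (lo, j)" "lo + 2 \<le> j" "j < h" | "p = (0, h - 1)" by blast
      then show "p \<in> r ` {0..<Suc M}"
      proof cases
        case (1 j)
        then have "p = r (nat (j - lo - 2))" "nat (j - lo - 2) < Suc M" using M by (auto simp: r_def)
        then show ?thesis by auto
      next
        case 2
        then have "p = r M" by (simp add: r_def)
        then show ?thesis by auto
      qed
    qed
  qed
  have sub: "?N \<subseteq> ordered_pairs n" "?R' \<subseteq> ordered_pairs n"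
    using lo by (auto simp: ordered_pairs_def)
  have labels: "set (map flip_label (steps f (Suc M) @ q)) = chords n s (return_labels lo h)"
  proof -
    have "return_labels lo h = ?N \<union> ?R'"
      using lo by (auto simp: return_labels_def)
    then show ?thesis
      using lab_old lab_new unfolding r_img by (simp only: map_append set_append chords_def image_Un)
  qed
  have dist_l: "distinct (map flip_label (steps f (Suc M) @ q))"
  proof -
    have "inj_on r {0..<Suc M}"
      by (rule inj_onI) (use lo in \<open>auto simp: r_def split: if_splits\<close>)
    then have "inj_on l {0..<Suc M}"
      unfolding l_def[abs_def]
      using comp_inj_on[of r "{0..<Suc M}" "\<lambda>(i, j). chord n s i j"]
        inj_on_subset[OF inj_on_chord[OF s, of n], of "r ` {0..<Suc M}"] r_sub
      by (auto simp: comp_def)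
    then have "distinct (map flip_label (steps f (Suc M)))"
      unfolding W(2) by (simp only: distinct_map set_upt distinct_upt simp_thms)
    moreover have "chords n s ?N \<inter> chords n s ?R' = {}"
      by (rule chords_disjoint[OF s sub]) (use lo in auto)
    ultimately show ?thesis
      using old(5) lab_old lab_new unfolding r_img by (simp only: map_append distinct_append simp_thms)
  qed
  show ?thesis
    using walk dist_v avoid contain dist_l labels unfolding return_walk_def by blast
qed

section \<open>Closing the one-rainbow cycle\<close>

lemma fan_hi_walk:
  assumes s: "\<bar>s\<bar> = 1" and lo: "1 \<le> lo" "lo < h" "h \<le> int n - 1" and n: "4 \<le> n"
  defines "f \<equiv> \<lambda>i. chords n s (fan_hi n (h - 1 - int i) h)"
    and "M \<equiv> nat (h - 1 - lo)"
  shows "flip_walk n (star n s) (steps f M) (chords n s (fan_hi n lo h))"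
    "map flip_label (steps f M) = map (\<lambda>i. chord n s (h - 2 - int i) h) [0..<M]"
proof -
  have f0: "f 0 = star n s" by (simp add: f_def star_eq_fan_hi[of n s h])
  have tri: "f 0 \<in> triangulations n" using star_triangulation[OF n s] f0 by simp
  have fl: "is_flip n (f i) (chord n s 0 (h - 1 - int i)) (chord n s (h - 2 - int i) h) (f (Suc i))"
    if "i < M" "f i \<in> triangulations n" for i
    using fan_hi_flip[OF s, of "h - 1 - int i" h n] that lo by (simp add: f_def M_def algebra_simps)
  have "f M = chords n s (fan_hi n lo h)" using lo by (simp add: f_def M_def)
  with flip_walk_steps[OF tri fl, of M] f0 show
    "flip_walk n (star n s) (steps f M) (chords n s (fan_hi n lo h))"
    "map flip_label (steps f M) = map (\<lambda>i. chord n s (h - 2 - int i) h) [0..<M]" by auto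
qed

lemma fan_hi_triangulation:
  assumes "\<bar>s\<bar> = 1" "1 \<le> lo" "lo < h" "h \<le> int n - 1" "4 \<le> n"
  shows "chords n s (fan_hi n lo h) \<in> triangulations n"
  using wf_digraph.awalk_last_in_verts[OF wf_flip_graph] fan_hi_walk(1)[OF assms]
  unfolding flip_walk_def by (fastforce simp: flip_graph_def)

text \<open>Induction on the size of the subpolygon. Orientation and ends are generalized, since the
  step calls the smaller walk in the reflected polygon.\<close>

lemma return_walk_exists:
  assumes "4 \<le> n" "\<bar>s\<bar> = 1" "1 \<le> lo" "h = lo + 2 + int d" "h \<le> int n - 1"
  shows "\<exists>q. return_walk n s lo h q"
  using assms(2-5)
proof (induction d arbitrary: s lo h)
  case 0
  then show ?case using return_walk_base[of s lo h n] assms(1) by auto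
next
  case (Suc d)
  have "\<exists>q. return_walk n (- s) (int n - (h - 1)) (int n - lo) q"
    by (rule Suc.IH) (use Suc.prems in auto)
  then obtain q where "return_walk n (- s) (int n - (h - 1)) (int n - lo) q" ..
  then show ?case
    using return_walk_step[of s lo h n q] fan_hi_triangulation[of s lo h n] Suc.prems assms(1) by auto
qed

lemma count_list_distinct: "distinct xs \<Longrightarrow> x \<in> set xs \<Longrightarrow> count_list xs x = 1"
  by (induction xs) (auto simp: count_list_0_iff)

text \<open>With \<open>lo = 1\<close> and \<open>h = n - 1\<close> the subpolygon is the whole
  polygon. The walk to the star at \<open>h\<close> adds the diagonals at \<open>h\<close>, the
  return walk all others; distinct labels that cover all diagonals have multiplicity one.\<close>

lemma one_rainbow_cycle:
  assumes n: "4 \<le> n"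
  shows "\<exists>p. rainbow_cycle n 1 p"
proof -
  define h where "h = int n - 1"
  have lo: "\<bar>1\<bar> = (1 :: int)" "(1 :: int) \<le> 1" "1 < h" "h \<le> int n - 1" using n by (auto simp: h_def)
  obtain q where "return_walk n 1 1 h q"
    using return_walk_exists[of n 1 1 h "n - 4"] n by (auto simp: h_def)
  then have q: "flip_walk n (chords n 1 (fan_hi n 1 h)) q (star n 1)" "distinct (map snd q)"
     "\<forall>T \<in> set (map snd q). \<forall>m. 1 \<le> m \<and> m < h - 1 \<longrightarrow> T \<noteq> chords n 1 (fan_hi n m h)"
     "distinct (map flip_label q)" "set (map flip_label q) = chords n 1 (return_labels 1 h)"
    unfolding return_walk_def by blast+
  define f where "f i = chords n 1 (fan_hi n (h - 1 - int i) h)" for i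
  define M where "M = nat (h - 1 - 1)"
  have M: "int M = h - 2" using n by (simp add: M_def h_def)
  define p where "p = steps f M"
  have p: "flip_walk n (star n 1) p (chords n 1 (fan_hi n 1 h))"
    "map flip_label p = map (\<lambda>i. chord n 1 (h - 2 - int i) h) [0..<M]"
    using fan_hi_walk[OF lo n] unfolding p_def f_def[abs_def] M_def by auto
  have dist_v: "distinct (map snd (p @ q))"
  proof -
    have "f (Suc i) \<noteq> f (Suc j)" if "i < j" "j < M" for i j
    proof -
      \<comment> \<open>The chord from \<open>h - 2 - j\<close> to \<open>h\<close> enters with step
        \<open>j\<close> and stays, so it separates \<open>f (Suc j)\<close> from all earlier
        fans.\<close>
      have lp: "(h - 2 - int j, h) \<in> ordered_pairs n" using that M by (auto simp: ordered_pairs_def h_def)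
      have "chord n 1 (h - 2 - int j) h \<in> f (Suc k) \<longleftrightarrow> (h - 2 - int j, h) \<in> fan_hi n (h - 1 - int (Suc k)) h"
        if "k < M" for k
        unfolding f_def
        by (rule chord_in_chords_iff[OF lo(1) lp fan_ordered_pairs(1)]) (use that M h_def in auto)
      from this[of i] this[of j] have "chord n 1 (h - 2 - int j) h \<notin> f (Suc i)"
        "chord n 1 (h - 2 - int j) h \<in> f (Suc j)"
        using that M by (auto simp: fan_defs)
      then show ?thesis by blast
    qed
    then have "inj_on (\<lambda>i. f (Suc i)) {0..<M}"
      by (intro linorder_inj_onI') auto
    then have "distinct (map snd p)"
      unfolding p_def by (simp only: map_snd_steps distinct_map set_upt distinct_upt simp_thms)
    moreover have "T \<notin> set (map snd q)" if T: "T \<in> set (map snd p)" for T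
    proof -
      \<comment> \<open>The heads of \<open>p\<close> are fans that a return walk avoids by
        definition.\<close>
      obtain i where "i < M" "T = f (Suc i)" using T unfolding p_def map_snd_steps by auto
      moreover from this have "1 \<le> h - 1 - int (Suc i)" "h - 1 - int (Suc i) < h - 1" using M by auto
      ultimately show ?thesis using q(3) unfolding f_def by blast
    qed
    ultimately show ?thesis using q(2) by (auto simp: image_iff)
  qed
  let ?r = "\<lambda>i. (h - 2 - int i, h)"
  have lab_p: "set (map flip_label p) = chords n 1 (?r ` {0..<M})"
    unfolding p(2) by (auto simp: chords_def)
  have sub: "?r ` {0..<M} \<subseteq> ordered_pairs n" "return_labels 1 h \<subseteq> ordered_pairs n"
    using M by (auto simp: ordered_pairs_def return_labels_def h_def)
  have dist_l: "distinct (map flip_label (p @ q))"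
  proof -
    have "inj_on (\<lambda>i. chord n 1 (h - 2 - int i) h) {0..<M}"
      using comp_inj_on[of ?r "{0..<M}" "\<lambda>(i, j). chord n 1 i j"]
        inj_on_subset[OF inj_on_chord[OF lo(1), of n] sub(1)]
      by (auto simp: comp_def inj_on_def)
    then have "distinct (map flip_label p)"
      unfolding p(2) by (simp only: distinct_map set_upt distinct_upt simp_thms)
    moreover have "chords n 1 (?r ` {0..<M}) \<inter> chords n 1 (return_labels 1 h) = {}"
      by (rule chords_disjoint[OF lo(1) sub]) (auto simp: return_labels_def)
    ultimately show ?thesis
      using q(4,5) lab_p by (simp only: map_append distinct_append simp_thms)
  qed
  have "e \<in> set (map flip_label (p @ q))" if e: "e \<in> diagonals n" for e
  proof -
    have "2 \<le> n" using n by simp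
    with e obtain x y where xy: "e = chord n 1 x y" "0 \<le> x" "x + 2 \<le> y" "y < int n"
      "\<not> (x = 0 \<and> y = int n - 1)"
      by (rule diagonal_is_chord)
    \<comment> \<open>The split is by whether the diagonal ends at \<open>h\<close>, the largest
      position.\<close>
    have "(x, y) \<in> ?r ` {0..<M} \<union> return_labels 1 h"
    proof (cases "y = h")
      case True
      then have "(x, y) = ?r (nat (h - 2 - x))" "nat (h - 2 - x) < M" using xy M by (auto simp: h_def)
      then show ?thesis by fastforce
    next
      case False
      then show ?thesis using xy by (auto simp: return_labels_def h_def)
    qed
    then show ?thesis using lab_p q(5) xy(1) unfolding map_append set_append chords_def by fastforce
  qed
  then have "count_list (map flip_label (p @ q)) e = 1" if "e \<in> diagonals n" for e
    using count_list_distinct[OF dist_l] that by blast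
  moreover have "p @ q \<noteq> []"
    using M n by (auto simp: p_def steps_def h_def)
  ultimately show ?thesis
    using rainbow_cycleI[OF flip_walk_append[OF p(1) q(1)] _ dist_v] by blast
qed

theorem theorem1:
  fixes n :: nat
  shows "(n \<ge> 4 \<longrightarrow> (\<exists>p. rainbow_cycle n 1 p)) \<and>
         (n \<ge> 7 \<longrightarrow> (\<exists>p. rainbow_cycle n 2 p))"
  using one_rainbow_cycle two_rainbow_cycle by blast

end
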